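(* Let $\mathbf{k}$ be a field. Then the ring homomorphisms $\varphi\colon \mathcal{R}_q^{+}\to\mathbf{k}$ are exactly the following (each choice of data below defines such a ring homomorphism, determined by the listed values, and every ring homomorphism $\mathcal{R}_q^{+}\to\mathbf{k}$ is of one of these forms): 1. ($q$ is sent to $0$.) For each choice of $k \in \mathbb{N}\cup\{\infty\}$, the map $\varphi$ with $\varphi(q)=0$ and, for each $m\in\mathbb{N}$, $\varphi\left(\genfrac{[}{]}{0pt}{}{x}{m}\right)=1$ if $m\le k$ and $\varphi\left(\genfrac{[}{]}{0pt}{}{x}{m}\right)=0$ otherwise. 2. ($q$ is sent to a root of unity.) For each choice of a positive integer $d$, a primitive $d$th root of unity $\omega\in\mathbf{k}$, an integer $n_0\in\{0,1,\dots,d-1\}$, and $t$ which is any element $t\in\mathbf{k}$ if $\mathrm{char}(\mathbf{k})=0$, or any $p$-adic integer $t\in\mathbb{Z}_p$ if $\mathrm{char}(\mathbf{k})=p>0$, the map $\varphi$ with $\varphi(q)=\omega$ and $$\varphi\left(\genfrac{[}{]}{0pt}{}{x}{m}\right)=\binom{\frac{t-n_0}{d}}{m'}\,\genfrac{[}{]}{0pt}{}{n_0}{m_0}_{q:=\omega}\qquad\text{for each } m\in\mathbb{N},$$ where $m=dm'+m_0$ with $m'\in\mathbb{N}$ and $m_0\in\{0,1,\dots,d-1\}$. 3. ($q$ is sent to an element that is neither zero nor a root of unity.) For each choice of $\kappa\in\mathbf{k}$ not equal to zero and not a root of unity, and each $t\in\mathbf{k}$, the map $\varphi$ with $\varphi(q)=\kappa$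 and $\varphi\left(\genfrac{[}{]}{0pt}{}{x}{m}\right)=\genfrac{[}{]}{0pt}{}{t}{m}_{q:=\kappa}$ for each $m\in\mathbb{N}$. The ring homomorphisms $\varphi\colon\mathcal{R}_q\to\mathbf{k}$ are exactly the following (each choice of data defines such a ring homomorphism, and no ring homomorphism $\mathcal{R}_q\to\mathbf{k}$ sends $q$ to zero): (i) for each choice of a positive integer $d$, a primitive $d$th root of unity $\omega\in\mathbf{k}$, an integer $n_0\in\{0,1,\dots,d-1\}$, and $t$ which is any element $t\in\mathbf{k}$ if $\mathrm{char}(\mathbf{k})=0$, or any $p$-adic integer $t\in\mathbb{Z}_p$ if $\mathrm{char}(\mathbf{k})=p>0$, the map $\varphi$ with $\varphi(q)=\omega$ and $\varphi\left(\genfrac{[}{]}{0pt}{}{x}{m}\right)=\binom{\frac{t-n_0}{d}}{m'}\,\genfrac{[}{]}{0pt}{}{n_0}{m_0}_{q:=\omega}$ for each $m\in\mathbb{N}$, where $m=dm'+m_0$ with $m'\in\mathbb{N}$ and $m_0\in\{0,1,\dots,d-1\}$; (ii) for each choice of $\kappa\in\mathbf{k}$ not equal to zero and not a root of unity, and each $t\in\mathbf{k}$, the map $\varphi$ with $\varphi(q)=\kappa$ and $\varphi\left(\genfrac{[}{]}{0pt}{}{x}{m}\right)=\genfrac{[}{]}{0pt}{}{t}{m}_{q:=\kappa}$ for each $m\in\mathbb{N}$.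
   Context: Here $q$ and $x$ are commuting indeterminates, $\mathbb{N}=\{0,1,2,\dots\}$. For $n\in\mathbb{Z}$, $[n]_q:=(q^n-1)/(q-1)\in\mathbb{Z}[q,q^{-1}]$, and for $n\in\mathbb{N}$, $[n]_q!:=[n]_q[n-1]_q\cdots[1]_q$ with $[0]_q!:=1$. For $n,k\in\mathbb{N}$, $\genfrac{[}{]}{0pt}{}{n}{k}_q:=\frac{[n]_q!}{[n-k]_q![k]_q!}$ if $k\le n$ and $0$ if $k>n$ (a polynomial in $\mathbb{Z}[q]$); $\genfrac{[}{]}{0pt}{}{n_0}{m_0}_{q:=\omega}$ denotes its evaluation at $q=\omega$. $\mathcal{R}_q^{+}:=\{P(x)\in\mathbb{Q}(q)[x] : P([n]_q)\in\mathbb{Z}[q]\text{ for all }n\in\mathbb{N}\}$ and $\mathcal{R}_q:=\{P(x)\in\mathbb{Q}(q)[x] : P([n]_q)\in\mathbb{Z}[q,q^{-1}]\text{ for all }n\in\mathbb{Z}\}$. The $q$-binomial coefficient polynomials are $\genfrac{[}{]}{0pt}{}{x}{k}:=\frac{x(x-[1]_q)\cdots(x-[k-1]_q)}{q^{\binom{k}{2}}[k]_q!}$ for $k\ge1$ and $\genfrac{[}{]}{0pt}{}{x}{0}:=1$. They form a $\mathbb{Z}[q]$-module basis of $\mathcal{R}_q^{+}$ and a $\mathbb{Z}[q,q^{-1}]$-module basis of $\mathcal{R}_q$, so a ring homomorphism from either ring is determined by the images of $q$ and of all $\genfrac{[}{]}{0pt}{}{x}{m}$, $m\in\mathbb{N}$.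 Meaning of $\binom{t}{m}$ for $m\in\mathbb{N}$: if $\mathrm{char}(\mathbf{k})=0$ and $t\in\mathbf{k}$, then $\binom{t}{m}:=t(t-1)\cdots(t-m+1)/m!\in\mathbf{k}$. If $\mathrm{char}(\mathbf{k})=p>0$ and $t\in\mathbb{Z}_p$ has base $p$ expansion $t=t_0+t_1p+t_2p^2+\cdots$ and $m=m_0+m_1p+\cdots+m_kp^k$ is the base $p$ expansion of $m$, then $\binom{t}{m}:=\binom{t_0}{m_0}\binom{t_1}{m_1}\cdots\binom{t_k}{m_k}\bmod p$, an element of $\mathbb{F}_p\subseteq\mathbf{k}$. (If $\mathrm{char}(\mathbf{k})=p>0$ and $\mathbf{k}$ contains a primitive $d$th root of unity then $p\nmid d$, so $\frac{t-n_0}{d}\in\mathbb{Z}_p$ for $t\in\mathbb{Z}_p$.) Meaning of $\genfrac{[}{]}{0pt}{}{t}{m}_{q:=\kappa}$ for $t\in\mathbf{k}$ and $\kappa\in\mathbf{k}$ nonzero and not a root of unity: the denominator $q^{\binom{m}{2}}[m]_q!$ is nonzero at $q=\kappa$, so $\genfrac{[}{]}{0pt}{}{x}{m}_{q:=\kappa}$ is a well-defined element of $\mathbf{k}[x]$, and $\genfrac{[}{]}{0pt}{}{t}{m}_{q:=\kappa}$ is its value at $x=t$. *)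

theory Defs
  imports
    "HOL-Computational_Algebra.Computational_Algebra"
    "HOL-Number_Theory.Cong"
    "HOL-Library.FuncSet"
    "HOL-Library.Extended_Nat"
begin

section \<open>The rings of $q$-integer-valued polynomials\<close>

text \<open>
  The field \<open>\<rat>(q)\<close> is \<^typ>\<open>rat poly fract\<close>, and \<open>\<rat>(q)[x]\<close> is \<^typ>\<open>rat poly fract poly\<close>.
\<close>

definition qvar :: "rat poly fract" where
  "qvar = to_fract [:0, 1:]"

definition of_Zq :: "int poly \<Rightarrow> rat poly fract" where
  "of_Zq f = to_fract (map_poly of_int f)"

definition Zq :: "rat poly fract set" where
  "Zq = range of_Zq"

definition Zq_laurent :: "rat poly fract set" where
  "Zq_laurent = {of_Zq f / qvar ^ k | f k. True}"

definition q_int :: "int \<Rightarrow> rat poly fract" where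
  "q_int n = (qvar powi n - 1) / (qvar - 1)"

definition q_fact :: "nat \<Rightarrow> rat poly fract" where
  "q_fact n = (\<Prod>i=1..n. q_int (int i))"

definition gauss_binom :: "nat \<Rightarrow> nat \<Rightarrow> rat poly fract" where
  "gauss_binom n k = (if k \<le> n then q_fact n / (q_fact (n - k) * q_fact k) else 0)"

definition Rq_plus :: "rat poly fract poly set" where
  "Rq_plus = {P. \<forall>n::nat. poly P (q_int (int n)) \<in> Zq}"

definition Rq :: "rat poly fract poly set" where
  "Rq = {P. \<forall>n::int. poly P (q_int n) \<in> Zq_laurent}"

text \<open>
  The factor for \<open>i = 0\<close> is \<open>x - [0]\<^sub>q = x\<close>, and the empty product gives the case \<open>k = 0\<close>.
\<close>

definition q_binom_poly :: "nat \<Rightarrow> rat poly fract poly" where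
  "q_binom_poly k =
     smult (1 / (qvar ^ (k choose 2) * q_fact k)) (\<Prod>i<k. [:- q_int (int i), 1:])"

section \<open>Ring homomorphisms into a field\<close>

text \<open>
  Unital ring homomorphisms on a subring \<open>R\<close> of the ambient ring. As functions in HOL are total,
  a homomorphism is required to be \<^term>\<open>undefined\<close> off \<open>R\<close>, so that two of them are equal
  exactly if they agree on \<open>R\<close>.
\<close>

definition ring_homs :: "'a::comm_ring_1 set \<Rightarrow> ('a \<Rightarrow> 'b::comm_ring_1) set" where
  "ring_homs R = {\<phi> \<in> extensional R.
     \<phi> 1 = 1 \<and>
     (\<forall>a\<in>R. \<forall>b\<in>R. \<phi> (a + b) = \<phi> a + \<phi> b) \<and>
     (\<forall>a\<in>R. \<forall>b\<in>R. \<phi> (a * b) = \<phi> a * \<phi> b)}"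

definition has_values ::
  "(rat poly fract poly \<Rightarrow> 'k::field) \<Rightarrow> 'k \<Rightarrow> (nat \<Rightarrow> 'k) \<Rightarrow> bool" where
  "has_values \<phi> \<kappa> b \<longleftrightarrow> \<phi> [:qvar:] = \<kappa> \<and> (\<forall>m. \<phi> (q_binom_poly m) = b m)"

definition primitive_root_of_unity :: "nat \<Rightarrow> 'k::field \<Rightarrow> bool" where
  "primitive_root_of_unity d \<omega> \<longleftrightarrow>
     d > 0 \<and> \<omega> ^ d = 1 \<and> (\<forall>e. 0 < e \<and> e < d \<longrightarrow> \<omega> ^ e \<noteq> 1)"

definition root_of_unity :: "'k::field \<Rightarrow> bool" where
  "root_of_unity \<kappa> \<longleftrightarrow> (\<exists>d>0. \<kappa> ^ d = 1)"

section \<open>Specialisation of $q$\<close>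

text \<open>
  The value at \<open>q = \<kappa>\<close> of a rational function that can be written with numerator \<open>f\<close> and
  denominator \<open>g\<close> in \<open>\<int>[q]\<close> such that \<open>g(\<kappa>) \<noteq> 0\<close> in the field; see \<open>q_eval_eqI\<close> below for the
  independence of the representation. (Integral representations are needed as the field may have
  positive characteristic.) It is only used on rational functions that admit such a representation.
\<close>

definition q_eval :: "'k::field \<Rightarrow> rat poly fract \<Rightarrow> 'k" where
  "q_eval \<kappa> r = (THE v. \<exists>f g. poly (map_poly of_int g) \<kappa> \<noteq> 0 \<and> r = of_Zq f / of_Zq g \<and>
     v = poly (map_poly of_int f) \<kappa> / poly (map_poly of_int g) \<kappa>)"

text \<open>\<open>q\<close>-binomial coefficients with an arbitrary upper entry \<open>t\<close> in the field: specialise the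
  coefficients of the polynomial at \<open>q = \<kappa>\<close>, then evaluate at \<open>x = t\<close>.\<close>

definition q_binom_eval :: "'k::field \<Rightarrow> 'k \<Rightarrow> nat \<Rightarrow> 'k" where
  "q_binom_eval \<kappa> t m = poly (map_poly (q_eval \<kappa>) (q_binom_poly m)) t"

section \<open>$p$-adic integers\<close>

text \<open>
  \<open>\<int>\<^sub>p\<close> as the inverse limit of the rings \<open>\<int>/p\<^sup>n\<close>: an element is the compatible sequence of its
  residues in \<open>{0..<p\<^sup>n}\<close>, and the operations are the componentwise ones.
\<close>

definition padic_ints :: "nat \<Rightarrow> (nat \<Rightarrow> int) set" where
  "padic_ints p = {a. \<forall>n. 0 \<le> a n \<and> a n < int p ^ n \<and> a (Suc n) mod int p ^ n = a n}"

definition padic_of_int :: "nat \<Rightarrow> int \<Rightarrow> nat \<Rightarrow> int" where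
  "padic_of_int p c = (\<lambda>n. c mod int p ^ n)"

definition padic_diff :: "nat \<Rightarrow> (nat \<Rightarrow> int) \<Rightarrow> (nat \<Rightarrow> int) \<Rightarrow> nat \<Rightarrow> int" where
  "padic_diff p a b = (\<lambda>n. (a n - b n) mod int p ^ n)"

definition padic_mult :: "nat \<Rightarrow> (nat \<Rightarrow> int) \<Rightarrow> (nat \<Rightarrow> int) \<Rightarrow> nat \<Rightarrow> int" where
  "padic_mult p a b = (\<lambda>n. (a n * b n) mod int p ^ n)"

definition padic_divide :: "nat \<Rightarrow> (nat \<Rightarrow> int) \<Rightarrow> (nat \<Rightarrow> int) \<Rightarrow> nat \<Rightarrow> int" where
  "padic_divide p a b = (THE c. c \<in> padic_ints p \<and> padic_mult p b c = a)"

text \<open>\<open>a mod p\<^bsup>i+1\<^esup> = a\<^sub>0 + a\<^sub>1 p + \<dots> + a\<^sub>i p\<^sup>i\<close>, so dividing by \<open>p\<^sup>i\<close> leaves the digit \<open>a\<^sub>i\<close>.\<close>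

definition padic_digit :: "nat \<Rightarrow> (nat \<Rightarrow> int) \<Rightarrow> nat \<Rightarrow> nat" where
  "padic_digit p a i = nat (a (Suc i) div int p ^ i)"

section \<open>Binomial coefficients in a field\<close>

text \<open>
  For a field of characteristic 0. (The constant \<^const>\<open>gbinomial\<close> of the library requires the class
  \<^class>\<open>semiring_char_0\<close>, whereas here the characteristic is not determined by the type class.)
\<close>

definition field_binom :: "'k::field \<Rightarrow> nat \<Rightarrow> 'k" where
  "field_binom t m = (\<Prod>i<m. t - of_nat i) / of_nat (fact m)"

text \<open>
  For characteristic \<open>p > 0\<close>: the product runs over the positions of the digits of \<open>m\<close>, and the
  result is to be read in the prime field, by applying \<^const>\<open>of_nat\<close>.
\<close>

definition padic_binom :: "nat \<Rightarrow> (nat \<Rightarrow> int) \<Rightarrow> nat \<Rightarrow> nat" where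
  "padic_binom p t m = (\<Prod>i\<in>{i. p ^ i \<le> m}. padic_digit p t i choose (m div p ^ i mod p))"

section \<open>The families of values\<close>

definition zero_values :: "enat \<Rightarrow> nat \<Rightarrow> 'k::field" where
  "zero_values k m = (if enat m \<le> k then 1 else 0)"

definition root_values_char0 :: "nat \<Rightarrow> 'k::field \<Rightarrow> nat \<Rightarrow> 'k \<Rightarrow> nat \<Rightarrow> 'k" where
  "root_values_char0 d \<omega> n0 t m =
     field_binom ((t - of_nat n0) / of_nat d) (m div d) * q_eval \<omega> (gauss_binom n0 (m mod d))"

definition root_values_charp :: "nat \<Rightarrow> 'k::field \<Rightarrow> nat \<Rightarrow> (nat \<Rightarrow> int) \<Rightarrow> nat \<Rightarrow> 'k" where
  "root_values_charp d \<omega> n0 t m =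
     (let p = CHAR('k);
          s = padic_divide p (padic_diff p t (padic_of_int p (int n0))) (padic_of_int p (int d))
      in of_nat (padic_binom p s (m div d)) * q_eval \<omega> (gauss_binom n0 (m mod d)))"

section \<open>Well-definedness\<close>

lemma of_Zq_mult: "of_Zq (f * g) = of_Zq f * of_Zq g"
proof -
  have "map_poly of_int (f * g) = (map_poly of_int f * map_poly of_int g :: rat poly)"
    by (intro poly_eqI) (simp add: coeff_map_poly coeff_mult)
  then show ?thesis
    by (simp add: of_Zq_def)
qed

lemma of_Zq_eq_iff: "of_Zq f = of_Zq g \<longleftrightarrow> f = g"
  by (auto simp: of_Zq_def poly_eq_iff coeff_map_poly)

lemma poly_map_of_int_mult:
  "poly (map_poly of_int (f * g)) (x::'k::field) =
     poly (map_poly of_int f) x * poly (map_poly of_int g) x"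
proof -
  have "map_poly of_int (f * g) = (map_poly of_int f * map_poly of_int g :: 'k poly)"
    by (intro poly_eqI) (simp add: coeff_map_poly coeff_mult)
  then show ?thesis
    by simp
qed

lemma q_eval_eqI:
  fixes \<kappa> :: "'k::field"
  assumes g: "poly (map_poly of_int g) \<kappa> \<noteq> 0"
  shows "q_eval \<kappa> (of_Zq f / of_Zq g) =
    poly (map_poly of_int f) \<kappa> / poly (map_poly of_int g) \<kappa>"
  unfolding q_eval_def
proof (rule the_equality)
  fix v
  assume "\<exists>f' g'. poly (map_poly of_int g') \<kappa> \<noteq> 0 \<and> of_Zq f / of_Zq g = of_Zq f' / of_Zq g' \<and>
     v = poly (map_poly of_int f') \<kappa> / poly (map_poly of_int g') \<kappa>"
  then obtain f' g' where g': "poly (map_poly of_int g') \<kappa> \<noteq> 0"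
    and eq: "of_Zq f / of_Zq g = of_Zq f' / of_Zq g'"
    and v: "v = poly (map_poly of_int f') \<kappa> / poly (map_poly of_int g') \<kappa>"
    by blast
  have nz: "of_Zq h \<noteq> 0" if "poly (map_poly of_int h) \<kappa> \<noteq> 0" for h
  proof
    assume "of_Zq h = 0"
    then have "of_Zq h = of_Zq 0"
      by (simp add: of_Zq_def)
    then show False
      using that by (simp add: of_Zq_eq_iff)
  qed
  have "of_Zq (f * g') = of_Zq (f' * g)"
    using eq nz[OF g] nz[OF g'] by (simp add: of_Zq_mult frac_eq_eq)
  then have "f * g' = f' * g"
    by (simp add: of_Zq_eq_iff)
  then have "poly (map_poly of_int (f * g')) \<kappa> = poly (map_poly of_int (f' * g)) \<kappa>"
    by simp
  then show "v = poly (map_poly of_int f) \<kappa> / poly (map_poly of_int g) \<kappa>"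
    using g g' by (simp add: poly_map_of_int_mult v frac_eq_eq)
qed (use g in blast)

lemma padic_divide_unique:
  assumes p: "p > 1" and a: "a \<in> padic_ints p" and d: "coprime d (int p)"
  shows "\<exists>!c. c \<in> padic_ints p \<and> padic_mult p (padic_of_int p d) c = a"
proof -
  define P where "P n = int p ^ n" for n
  have P: "P n > 0" "P n dvd P (Suc n)" "coprime d (P n)" for n
    using p d by (auto simp: P_def)
  have a': "0 \<le> a n" "a n < P n" "a (Suc n) mod P n = a n" for n
    using a by (auto simp: padic_ints_def P_def)
  have uniq: "x = y" if "0 \<le> x" "x < P n" "0 \<le> y" "y < P n" "[d * x = d * y] (mod P n)" for x y n
  proof -
    have "[x = y] (mod P n)"
      using that(5) P(3)[of n] cong_mult_lcancel by blast
    then show ?thesis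
      using that by (simp add: cong_def)
  qed
  have "\<exists>c. 0 \<le> c \<and> c < P n \<and> [d * c = a n] (mod P n)" for n
  proof -
    obtain e where e: "[d * e = 1] (mod P n)"
      using cong_solve_coprime_int[OF P(3)] by blast
    have "[d * (e * a n mod P n) = d * (e * a n)] (mod P n)"
      by (simp add: cong_def mod_mult_right_eq)
    also have "[d * (e * a n) = a n] (mod P n)"
      using cong_scalar_right[OF e, of "a n"] by (simp add: mult.assoc)
    finally show ?thesis
      using P(1) by (intro exI[of _ "e * a n mod P n"]) auto
  qed
  then obtain c where c: "0 \<le> c n" "c n < P n" "[d * c n = a n] (mod P n)" for n
    by metis
  have c_Suc: "c (Suc n) mod P n = c n" for n
  proof (rule uniq)
    have "[d * (c (Suc n) mod P n) = d * c (Suc n)] (mod P n)"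
      by (simp add: cong_def mod_mult_right_eq)
    also have "[d * c (Suc n) = a (Suc n)] (mod P n)"
      using c(3)[of "Suc n"] P(2) cong_dvd_modulus by blast
    also have "[a (Suc n) = a n] (mod P n)"
      using a' by (simp add: cong_def)
    also have "[a n = d * c n] (mod P n)"
      using c(3) cong_sym by blast
    finally show "[d * (c (Suc n) mod P n) = d * c n] (mod P n)" .
  qed (use P(1) c in auto)
  have mult: "padic_mult p (padic_of_int p d) b n = d * b n mod P n" for b n
    by (simp add: padic_mult_def padic_of_int_def P_def mod_mult_left_eq)
  show ?thesis
  proof (intro ex1I conjI)
    show "c \<in> padic_ints p"
      using c c_Suc by (auto simp: padic_ints_def P_def)
    show "padic_mult p (padic_of_int p d) c = a"
      using c(3) a' by (auto simp: mult cong_def)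
  next
    fix b assume b: "b \<in> padic_ints p \<and> padic_mult p (padic_of_int p d) b = a"
    show "b = c"
    proof
      fix n
      have "d * b n mod P n = a n"
        using b mult by metis
      then have "[d * b n = d * c n] (mod P n)"
        using c(3)[of n] a'[of n] by (simp add: cong_def)
      moreover have "0 \<le> b n" "b n < P n"
        using b by (auto simp: padic_ints_def P_def)
      ultimately show "b n = c n"
        using uniq[of "b n" n "c n"] c(1,2) by blast
    qed
  qed
qed

end

theory Submission
  imports Defs
begin

text \<open>
  Write \<open>B\<^sub>m\<close> for the \<open>q\<close>-binomial coefficient polynomials. As \<open>B\<^sub>m([n]\<^sub>q)\<close> is the Gaussian binomial
  coefficient of \<open>n\<close> and \<open>m\<close>, which vanishes for \<open>n < m\<close> and is \<open>1\<close> for \<open>n = m\<close>, a polynomial has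
  values in \<open>\<int>[q]\<close> at all \<open>[n]\<^sub>q\<close>, \<open>n \<ge> 0\<close>, if and only if its coordinates with respect to the \<open>B\<^sub>m\<close>,
  computed from these values by a triangular recursion, lie in \<open>\<int>[q]\<close>. So a homomorphism \<open>\<phi>\<close> with
  \<open>\<phi>(q) = \<kappa>\<close> is determined by its values \<open>b\<^sub>m = \<phi>(B\<^sub>m)\<close>, and the question is which families \<open>b\<close> occur
  (\<open>admissible\<close>).

  Existence. Evaluation at \<open>x = [n]\<^sub>q\<close>, \<open>q = \<kappa>\<close> gives the admissible family of Gaussian binomial
  coefficients of \<open>n\<close> at \<open>\<kappa>\<close>. For two given polynomials, multiplicativity is an algebraic equation
  between finitely many of the \<open>b\<^sub>m\<close>. Hence admissible families are closed under pointwise limits in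
  the discrete topology (\<open>admissible_limit\<close>), and a family that depends polynomially on a parameter is
  admissible throughout if it is so for infinitely many parameters (\<open>admissible_interpolation\<close>).
  The evaluations and their limit for \<open>n \<rightarrow> \<infinity>\<close> supply \<open>q \<mapsto> 0\<close>; limits in \<open>\<int>\<^sub>p\<close> supply roots of unity
  in characteristic \<open>p\<close>; interpolation supplies roots of unity in characteristic 0 and all remaining \<open>\<kappa>\<close>.

  Classification. If a polynomial \<open>P\<close> takes values at the \<open>[n]\<^sub>q\<close> that all vanish at \<open>q = \<kappa>\<close>, then so do
  its coordinates, and \<open>\<phi>(P) = 0\<close> (\<open>hom_eq_0\<close>). So the \<open>b\<^sub>m\<close> satisfy all polynomial relations which the
  Gaussian binomial coefficients at \<open>\<kappa>\<close> satisfy for every \<open>n\<close>. In particular, if for indices in a finite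
  set only finitely many values occur, then on this set \<open>b\<close> coincides with the Gaussian binomial
  coefficients of a single \<open>n\<close>: otherwise a product of differences would be killed by \<open>\<phi>\<close> without a
  vanishing factor (\<open>finite_approximation\<close>). This covers \<open>\<kappa> = 0\<close>, where the values are 0 and 1, and roots
  of unity in characteristic \<open>p\<close>, where the \<open>q\<close>-Lucas congruence (\<open>qbinomial_at_root\<close>) leaves finitely
  many values and the approximating \<open>n\<close> form a \<open>p\<close>-adically convergent sequence. At a root of unity of
  order \<open>d\<close> in characteristic 0 the same argument gives \<open>n\<^sub>0\<close>, and the \<open>b\<^bsub>dm\<^esub>\<close> satisfy the recurrence of
  the binomial coefficients. For other \<open>\<kappa>\<close> the recurrence of the \<open>B\<^sub>m\<close> determines \<open>b\<close> from \<open>b\<^sub>1\<close>.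

  The \<open>B\<^sub>m\<close> take values in \<open>\<int>[q, 1/q]\<close> at \<open>[n]\<^sub>q\<close> for negative \<open>n\<close> too, so the ring \<open>Rq\<close> is the
  localisation of \<open>Rq_plus\<close> at \<open>q\<close>; its homomorphisms are those of \<open>Rq_plus\<close> with \<open>\<kappa> \<noteq> 0\<close>
  (\<open>ex1_ring_hom_Rq\<close>).
\<close>

section \<open>Gaussian binomial coefficients\<close>

text \<open>
  The recursion makes sense in every commutative ring. Hence specialising \<open>q\<close> commutes with it, and the
  Gaussian binomial coefficients at \<open>q = 1\<close>, \<open>q = 0\<close> and at roots of unity are all instances.
\<close>

fun qbinomial :: "'a::comm_ring_1 \<Rightarrow> nat \<Rightarrow> nat \<Rightarrow> 'a" where
  "qbinomial q n 0 = 1"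
| "qbinomial q 0 (Suc k) = 0"
| "qbinomial q (Suc n) (Suc k) = qbinomial q n k + q ^ Suc k * qbinomial q n (Suc k)"

definition qnat :: "'a::comm_ring_1 \<Rightarrow> nat \<Rightarrow> 'a" where
  "qnat q n = (\<Sum>i<n. q ^ i)"

lemma qnat_0 [simp]: "qnat q 0 = 0"
  by (simp add: qnat_def)

lemma qnat_Suc: "qnat q (Suc n) = 1 + q * qnat q n"
  by (simp add: qnat_def sum.lessThan_Suc_shift sum_distrib_left del: sum.lessThan_Suc)

lemma qnat_1 [simp]: "qnat q (Suc 0) = 1"
  by (simp add: qnat_Suc)

lemma qbinomial_eq_0: "n < k \<Longrightarrow> qbinomial q n k = 0"
  by (induction q n k rule: qbinomial.induct) auto

lemma qbinomial_self [simp]: "qbinomial q n n = 1"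
  by (induction n) (auto simp: qbinomial_eq_0)

lemma qbinomial_1: "qbinomial q n (Suc 0) = qnat q n"
  by (induction n) (auto simp: qnat_Suc)

lemma qbinomial_at_1: "qbinomial 1 n k = of_nat (n choose k)"
  by (induction "1::'a" n k rule: qbinomial.induct) auto

lemma qbinomial_at_0: "qbinomial 0 n k = (if k \<le> n then 1 else 0)"
  by (induction "0::'a" n k rule: qbinomial.induct) auto

text \<open>
  In a field this follows by dividing factorials; an induction along the Pascal recursion gives the
  identity where the \<open>[i]\<^sub>q\<close> may be zero divisors.
\<close>

lemma qbinomial_absorption:
  "qnat q (Suc k) * qbinomial q (Suc n) (Suc k) = qnat q (Suc n) * qbinomial q n k"
proof (induction n arbitrary: k)
  case 0
  then show ?case by (cases k) simp_all
next
  case (Suc n)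
  show ?case
  proof (cases k)
    case 0
    then show ?thesis
      using qbinomial_1[of q "Suc (Suc n)"] by simp
  next
    case (Suc j)
    note IH1 = Suc.IH[of k] and IH2 = Suc.IH[of j]
    have pascal: "qbinomial q (Suc n) k = qbinomial q n j + q ^ k * qbinomial q n k"
      by (simp add: Suc)
    have "qnat q (Suc k) * qbinomial q (Suc (Suc n)) (Suc k)
        = (1 + q * qnat q k) * qbinomial q (Suc n) k
          + q ^ Suc k * (qnat q (Suc k) * qbinomial q (Suc n) (Suc k))"
      by (simp only: qbinomial.simps qnat_Suc[of q k]) (simp only: algebra_simps)
    also have "\<dots> = qbinomial q (Suc n) k + q * (qnat q k * qbinomial q (Suc n) k)
          + q ^ Suc k * (qnat q (Suc n) * qbinomial q n k)"
      by (simp only: IH1) (simp add: algebra_simps)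
    also have "qnat q k * qbinomial q (Suc n) k = qnat q (Suc n) * qbinomial q n j"
      using IH2 by (simp only: Suc)
    also have "qbinomial q (Suc n) k + q * (qnat q (Suc n) * qbinomial q n j)
          + q ^ Suc k * (qnat q (Suc n) * qbinomial q n k)
        = qbinomial q (Suc n) k + q * qnat q (Suc n) * (qbinomial q n j + q ^ k * qbinomial q n k)"
      by (simp add: algebra_simps)
    also have "\<dots> = qnat q (Suc (Suc n)) * qbinomial q (Suc n) k"
      by (simp only: pascal[symmetric] qnat_Suc[of q "Suc n"]) (simp only: algebra_simps mult_1_left)
    finally show ?thesis .
  qed
qed

text \<open>
  One induction along the Pascal recursion proves two congruences: at a root of unity of order \<open>d\<close> it is
  the \<open>q\<close>-Lucas congruence, at \<open>q = 1\<close> and \<open>d = p\<close> in characteristic \<open>p\<close> it is the classical theorem of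
  Lucas. All they share is that the \<open>d\<close>-th row of the triangle vanishes except at both ends.
\<close>

lemma qbinomial_lucas:
  fixes q :: "'a::comm_ring_1"
  assumes d: "d > 0" and qd: "q ^ d = 1"
    and mid: "\<And>j. 0 < j \<Longrightarrow> j < d \<Longrightarrow> qbinomial q d j = 0"
  shows "qbinomial q n m = of_nat (n div d choose (m div d)) * qbinomial q (n mod d) (m mod d)"
proof (induction n arbitrary: m)
  case 0
  then show ?case
  proof (cases "m mod d = 0")
    case True
    then have m: "m = d * (m div d)" using mult_div_mod_eq[of d m] by simp
    show ?thesis
    proof (cases m)
      case (Suc k)
      then have "m div d \<noteq> 0" using m by (metis mult_0_right nat.distinct(1))
      then show ?thesis using Suc by (simp add: binomial_eq_0)
    qed simp
  next
    case False
    then have "m \<noteq> 0" by (cases m) auto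
    then show ?thesis using False by (cases m; cases "m mod d") auto
  qed
next
  case (Suc n)
  show ?case
  proof (cases m)
    case 0
    then show ?thesis by simp
  next
    case (Suc k)
    define n' n0 k' k0 where "n' = n div d" and "n0 = n mod d" and "k' = k div d" and "k0 = k mod d"
    have lt: "n0 < d" "k0 < d" using d by (simp_all add: n0_def k0_def)
    have n: "n = d * n' + n0" and k: "k = d * k' + k0"
      by (simp_all add: n'_def n0_def k'_def k0_def)
    have qk: "q ^ Suc k = q ^ Suc k0"
      by (simp add: k power_add power_mult qd)
    have split: "Suc (d * a + a0) div d = (if Suc a0 = d then Suc a else a)"
      "Suc (d * a + a0) mod d = (if Suc a0 = d then 0 else Suc a0)" if "a0 < d" for a a0
    proof -
      have "Suc (d * a + a0) = d * Suc a" if "Suc a0 = d"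
        using that by simp
      moreover have "Suc (d * a + a0) = d * a + Suc a0" by simp
      moreover have "Suc a0 < d" if "Suc a0 \<noteq> d" using that \<open>a0 < d\<close> by simp
      ultimately show "Suc (d * a + a0) div d = (if Suc a0 = d then Suc a else a)"
      "Suc (d * a + a0) mod d = (if Suc a0 = d then 0 else Suc a0)"
        using d by (metis div_mult_self1_is_m mod_mult_self1_is_0 div_mult_self4 add.right_neutral div_less mod_less mod_mult_self4 neq0_conv)+
    qed
    note next_n = split[OF lt(1), of n', folded n] and next_k = split[OF lt(2), of k', folded k]
    have IH1: "qbinomial q n k = of_nat (n' choose k') * qbinomial q n0 k0"
      using Suc.IH[of k] by (simp add: n'_def n0_def k'_def k0_def)
    have IH2: "qbinomial q n (Suc k) = (if Suc k0 = d then of_nat (n' choose Suc k')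
        else of_nat (n' choose k') * qbinomial q n0 (Suc k0))"
      using Suc.IH[of "Suc k"] by (simp add: next_k flip: n'_def n0_def)
    have L: "qbinomial q (Suc n) (Suc k) =
       of_nat (n' choose k') * qbinomial q n0 k0 + q ^ Suc k0 * (if Suc k0 = d then of_nat (n' choose Suc k')
        else of_nat (n' choose k') * qbinomial q n0 (Suc k0))"
      by (simp only: qbinomial.simps qk IH1 IH2)
    \<comment> \<open>A carry in the lower index turns the recursion into the classical Pascal rule for the
      quotients; without one it is the recursion for the remainders, and then a carry in the upper index
      produces an entry of row \<open>d\<close>.\<close>
    have "qbinomial q (Suc n) (Suc k) = of_nat (Suc n div d choose (Suc k div d)) * qbinomial q (Suc n mod d) (Suc k mod d)"
    proof (cases "Suc k0 = d")
      case top: True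
      have "q ^ Suc k0 = 1" using top qd by simp
      then show ?thesis
        using lt top L qbinomial_eq_0[of n0 k0 q] unfolding next_n next_k
        by (cases "n0 = k0") auto
    next
      case low: False
      have "qbinomial q (Suc n) (Suc k) = of_nat (n' choose k') * qbinomial q (Suc n0) (Suc k0)"
        unfolding L using low by (simp add: algebra_simps)
      moreover have "qbinomial q (Suc n0) (Suc k0) = 0" if "Suc n0 = d"
        using mid[of "Suc k0"] that low lt by simp
      ultimately show ?thesis
        using low unfolding next_n next_k by auto
    qed
    then show ?thesis by (simp only: Suc)
  qed
qed

section \<open>The \<open>q\<close>-binomial coefficient polynomials\<close>

lemma qvar_power: "qvar ^ n = to_fract (monom 1 n)"
proof -
  have "to_fract (p ^ n) = to_fract p ^ n" for p :: "rat poly"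
    by (induction n) simp_all
  then show ?thesis
    by (simp add: qvar_def monom_altdef)
qed

lemma qvar_power_eq_1_iff: "qvar ^ n = 1 \<longleftrightarrow> n = 0"
proof -
  have "qvar ^ n = 1 \<longleftrightarrow> monom (1::rat) n = monom 1 0"
    by (simp add: qvar_power monom_0 flip: to_fract_1 one_pCons)
  also have "\<dots> \<longleftrightarrow> n = 0"
    by (metis degree_monom_eq one_neq_zero)
  finally show ?thesis .
qed

lemma qvar_neq [simp]: "qvar \<noteq> 0" "qvar \<noteq> 1"
  using qvar_power_eq_1_iff[of 1] by (auto simp: qvar_def)

lemma q_int_of_nat: "q_int (int n) = qnat qvar n"
  by (simp add: q_int_def qnat_def geometric_sum)

lemma q_int_0 [simp]: "q_int 0 = 0" and q_int_1 [simp]: "q_int 1 = 1"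
  by (simp_all add: q_int_def)

lemma q_int_diff: "q_int a - q_int b = qvar powi b * q_int (a - b)"
proof -
  have "qvar powi b * qvar powi (a - b) = qvar powi a"
    by (simp flip: power_int_add)
  then show ?thesis
    by (simp add: q_int_def right_diff_distrib flip: diff_divide_distrib)
qed

lemma q_int_eq_0_iff [simp]: "q_int n = 0 \<longleftrightarrow> n = 0"
proof -
  have "qvar powi n = 1 \<longleftrightarrow> n = 0"
    using qvar_power_eq_1_iff by (cases n rule: int_cases2) (auto simp: power_int_minus)
  then show ?thesis
    by (simp add: q_int_def)
qed

lemma q_int_eq_iff [simp]: "q_int a = q_int b \<longleftrightarrow> a = b"
  using q_int_diff[of a b] q_int_eq_0_iff[of "a - b"] by auto

lemma q_fact_Suc: "q_fact (Suc n) = q_int (int (Suc n)) * q_fact n"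
  by (simp add: q_fact_def)

lemma q_fact_neq_0 [simp]: "q_fact n \<noteq> 0"
  by (simp add: q_fact_def)

lemma q_binom_poly_0 [simp]: "q_binom_poly 0 = 1"
  by (simp add: q_binom_poly_def q_fact_def numeral_2_eq_2)

lemma q_binom_poly_Suc:
  "smult (qvar ^ k * q_int (int (Suc k))) (q_binom_poly (Suc k)) =
    [:- q_int (int k), 1:] * q_binom_poly k"
proof -
  have "Suc k choose 2 = k + (k choose 2)"
    by (simp add: numeral_2_eq_2)
  then have "qvar ^ (Suc k choose 2) * q_fact (Suc k) =
      (qvar ^ k * q_int (int (Suc k))) * (qvar ^ (k choose 2) * q_fact k)"
    by (simp add: power_add q_fact_Suc del: binomial_Suc_Suc)
  moreover have "qvar ^ k * q_int (int (Suc k)) \<noteq> 0" by simp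
  ultimately show ?thesis
    by (simp add: q_binom_poly_def mult.commute del: binomial_Suc_Suc of_nat_Suc)
qed

lemma q_binom_poly_q_int_Suc:
  "q_int (int (Suc k)) * poly (q_binom_poly (Suc k)) (q_int n) =
    q_int (n - int k) * poly (q_binom_poly k) (q_int n)"
proof -
  have "qvar ^ k * (q_int (int (Suc k)) * poly (q_binom_poly (Suc k)) (q_int n)) =
      (q_int n - q_int (int k)) * poly (q_binom_poly k) (q_int n)"
    using arg_cong[OF q_binom_poly_Suc[of k], of "\<lambda>P. poly P (q_int n)"]
    by (simp add: algebra_simps)
  also have "\<dots> = qvar ^ k * (q_int (n - int k) * poly (q_binom_poly k) (q_int n))"
    by (simp add: q_int_diff)
  finally show ?thesis by simp
qed

text \<open>
  Stated for integers \<open>n\<close>: read upwards it computes the values at \<open>[n]\<^sub>q\<close> for \<open>n \<ge> 0\<close>, read downwards it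
  bounds the denominators at negative \<open>n\<close>.
\<close>

lemma q_binom_poly_pascal:
  "poly (q_binom_poly (Suc k)) (q_int (n + 1)) =
    poly (q_binom_poly k) (q_int n) + qvar ^ Suc k * poly (q_binom_poly (Suc k)) (q_int n)"
proof (induction k)
  case 0
  have "q_int (n + 1) = 1 + qvar * q_int n"
    using q_int_diff[of "n + 1" 1] by (simp add: algebra_simps)
  then show ?case
    using q_binom_poly_q_int_Suc[of 0 "n + 1"] q_binom_poly_q_int_Suc[of 0 n] by simp
next
  case (Suc k)
  let ?G = "\<lambda>n k. poly (q_binom_poly k) (q_int n)"
  define K where "K = Suc k"
  have split: "q_int (int j) + qvar ^ j * q_int (n + 1 - int j) = q_int (n + 1)" for j
    using q_int_diff[of "n + 1" "int j"] by (simp add: algebra_simps)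
  have "q_int (int (Suc K)) * ?G (n + 1) (Suc K) = q_int (n + 1 - int K) * ?G (n + 1) K"
    by (rule q_binom_poly_q_int_Suc)
  also have "\<dots> = q_int (n - int k) * ?G n k + qvar ^ K * (q_int (n + 1 - int K) * ?G n K)"
    using Suc.IH by (simp add: K_def algebra_simps)
  also have "q_int (n - int k) * ?G n k = q_int (int K) * ?G n K"
    using q_binom_poly_q_int_Suc[of k n] by (simp add: K_def)
  also have "\<dots> + qvar ^ K * (q_int (n + 1 - int K) * ?G n K) = q_int (n + 1) * ?G n K"
    using split[of K] by (metis distrib_right mult.assoc)
  also have "\<dots> = (q_int (int (Suc K)) + qvar ^ Suc K * q_int (n - int K)) * ?G n K"
    using split[of "Suc K"] by simp
  also have "\<dots> = q_int (int (Suc K)) * ?G n K + qvar ^ Suc K * (q_int (int (Suc K)) * ?G n (Suc K))"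
    by (simp only: q_binom_poly_q_int_Suc[of K n] algebra_simps)
  also have "\<dots> = q_int (int (Suc K)) * (?G n K + qvar ^ Suc K * ?G n (Suc K))"
    by (simp only: algebra_simps)
  finally show ?case
    by (simp add: K_def del: of_nat_Suc power_Suc)
qed

text \<open>
  The bridge between the two sides of the problem: the polynomial evaluated at \<open>[n]\<^sub>q\<close> lies in \<open>\<int>[q]\<close> and
  has a specialisation at every element of every field.
\<close>

lemma q_binom_poly_at_nat: "poly (q_binom_poly k) (q_int (int n)) = qbinomial qvar n k"
proof (induction qvar n k rule: qbinomial.induct)
  case (2 k)
  have "poly (q_binom_poly (Suc k)) (q_int 0) = 0" for k
  proof (induction k)
    case 0 show ?case using q_binom_poly_q_int_Suc[of 0 0] by simp
  next
    case (Suc k) then show ?case using q_binom_poly_q_int_Suc[of "Suc k" 0] by simp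
  qed
  then show ?case by simp
next
  case (3 n k)
  then show ?case using q_binom_poly_pascal[of k "int n"] by (simp add: add.commute)
qed simp

lemma gauss_binom_eq: "gauss_binom n k = qbinomial qvar n k"
proof (cases "k \<le> n")
  case True
  then show ?thesis
  proof (induction k)
    case 0 show ?case by (simp add: gauss_binom_def q_fact_def)
  next
    case (Suc k)
    have "q_fact (n - k) = q_int (int n - int k) * q_fact (n - Suc k)"
      using q_fact_Suc[of "n - Suc k"] Suc.prems by (simp add: Suc_diff_Suc of_nat_diff del: of_nat_Suc)
    then have "q_int (int (Suc k)) * gauss_binom n (Suc k) = q_int (int n - int k) * gauss_binom n k"
      using Suc.prems by (simp add: gauss_binom_def q_fact_Suc field_simps del: of_nat_Suc)
    also have "\<dots> = q_int (int (Suc k)) * qbinomial qvar n (Suc k)"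
      using Suc q_binom_poly_q_int_Suc[of k "int n"] by (simp add: q_binom_poly_at_nat del: of_nat_Suc)
    finally show ?case by (simp del: of_nat_Suc)
  qed
qed (simp add: gauss_binom_def qbinomial_eq_0)

section \<open>Subrings and their homomorphisms\<close>

definition subring_set :: "'a::comm_ring_1 set \<Rightarrow> bool" where
  "subring_set R \<longleftrightarrow> 1 \<in> R \<and> (\<forall>a\<in>R. \<forall>b\<in>R. a - b \<in> R \<and> a * b \<in> R)"

lemma subring_setI:
  assumes "1 \<in> R" "\<And>a b. a \<in> R \<Longrightarrow> b \<in> R \<Longrightarrow> a - b \<in> R" "\<And>a b. a \<in> R \<Longrightarrow> b \<in> R \<Longrightarrow> a * b \<in> R"
  shows "subring_set R"
  using assms by (simp add: subring_set_def)

context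
  fixes R :: "'a::comm_ring_1 set"
  assumes R: "subring_set R"
begin

lemma subring_one: "1 \<in> R"
  and subring_diff: "a \<in> R \<Longrightarrow> b \<in> R \<Longrightarrow> a - b \<in> R"
  and subring_mult: "a \<in> R \<Longrightarrow> b \<in> R \<Longrightarrow> a * b \<in> R"
  using R by (auto simp: subring_set_def)

lemma subring_zero: "0 \<in> R"
  using subring_diff[OF subring_one subring_one] by simp

lemma subring_add: "a \<in> R \<Longrightarrow> b \<in> R \<Longrightarrow> a + b \<in> R"
  using subring_diff[of a "0 - b"] subring_diff[of 0 b] subring_zero by simp

lemma subring_sum: "(\<And>i. i \<in> I \<Longrightarrow> f i \<in> R) \<Longrightarrow> sum f I \<in> R"
  by (induction I rule: infinite_finite_induct) (auto intro: subring_add subring_zero)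

lemma subring_prod: "(\<And>i. i \<in> I \<Longrightarrow> f i \<in> R) \<Longrightarrow> prod f I \<in> R"
  by (induction I rule: infinite_finite_induct) (auto intro: subring_mult subring_one)

lemma subring_power: "a \<in> R \<Longrightarrow> a ^ n \<in> R"
  by (induction n) (auto intro: subring_mult subring_one)

lemma subring_of_nat: "of_nat n \<in> R"
  by (induction n) (auto intro: subring_zero subring_add subring_one)

lemma subring_of_int: "of_int n \<in> R"
  by (cases n rule: int_diff_cases) (simp add: subring_diff subring_of_nat)

end

text \<open>
  Covers both the homomorphisms to be classified and the specialisation of \<open>q\<close>, which is multiplicative
  only on the rational functions that are regular at the chosen point.
\<close>

locale subring_hom =
  fixes R :: "'a::comm_ring_1 set" and \<phi> :: "'a \<Rightarrow> 'b::comm_ring_1"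
  assumes subring: "subring_set R"
    and hom_one: "\<phi> 1 = 1"
    and hom_add: "a \<in> R \<Longrightarrow> b \<in> R \<Longrightarrow> \<phi> (a + b) = \<phi> a + \<phi> b"
    and hom_mult: "a \<in> R \<Longrightarrow> b \<in> R \<Longrightarrow> \<phi> (a * b) = \<phi> a * \<phi> b"
begin

lemma hom_zero: "\<phi> 0 = 0"
  using hom_add[of 0 0] subring_zero[OF subring] by simp

lemma hom_diff: "a \<in> R \<Longrightarrow> b \<in> R \<Longrightarrow> \<phi> (a - b) = \<phi> a - \<phi> b"
  using hom_add[of "a - b" b] subring_diff[OF subring] by (simp add: algebra_simps)

lemma hom_sum: "(\<And>i. i \<in> I \<Longrightarrow> f i \<in> R) \<Longrightarrow> \<phi> (sum f I) = (\<Sum>i\<in>I. \<phi> (f i))"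
  by (induction I rule: infinite_finite_induct)
    (auto simp: hom_zero hom_add subring_sum[OF subring])

lemma hom_prod: "(\<And>i. i \<in> I \<Longrightarrow> f i \<in> R) \<Longrightarrow> \<phi> (prod f I) = (\<Prod>i\<in>I. \<phi> (f i))"
  by (induction I rule: infinite_finite_induct)
    (auto simp: hom_one hom_mult subring_prod[OF subring])

lemma hom_power: "a \<in> R \<Longrightarrow> \<phi> (a ^ n) = \<phi> a ^ n"
  by (induction n) (auto simp: hom_one hom_mult subring_power[OF subring])

lemma hom_of_nat: "\<phi> (of_nat n) = of_nat n"
  by (induction n) (auto simp: hom_zero hom_one hom_add subring_of_nat[OF subring] subring_one[OF subring])

lemma hom_of_int: "\<phi> (of_int n) = of_int n"
  by (cases n rule: int_diff_cases) (simp add: hom_diff hom_of_nat subring_of_nat[OF subring])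

lemma hom_qnat: "q \<in> R \<Longrightarrow> \<phi> (qnat q n) = qnat (\<phi> q) n"
  by (simp add: qnat_def hom_sum hom_power subring_power[OF subring])

end

lemma subring_qbinomial: "subring_set R \<Longrightarrow> q \<in> R \<Longrightarrow> qbinomial q n k \<in> R"
  by (induction q n k rule: qbinomial.induct)
    (auto intro!: subring_one subring_zero subring_add subring_mult subring_power)

lemma (in subring_hom) hom_qbinomial: "q \<in> R \<Longrightarrow> \<phi> (qbinomial q n k) = qbinomial (\<phi> q) n k"
proof (induction q n k rule: qbinomial.induct)
  case (3 q n k)
  have "qbinomial q a b \<in> R" "q ^ a \<in> R" "q ^ a * qbinomial q b c \<in> R" for a b c
    using 3 subring by (simp_all add: subring_qbinomial subring_power subring_mult)
  then show ?case
    using 3 by (simp add: hom_add hom_mult hom_power del: power_Suc)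
qed (simp_all add: hom_one hom_zero)

lemma subring_set_preimage_poly:
  assumes "subring_set S"
  shows "subring_set {P. \<forall>n. poly P (f n) \<in> S}"
  using assms by (auto simp: subring_set_def)

section \<open>Specialising \<open>q\<close>\<close>

lemma map_poly_of_int_simps:
  fixes f g :: "int poly"
  shows "map_poly of_int (f + g) = (map_poly of_int f + map_poly of_int g :: 'a::idom poly)"
    "map_poly of_int (f - g) = (map_poly of_int f - map_poly of_int g :: 'a poly)"
    "map_poly of_int (pCons a f) = (pCons (of_int a) (map_poly of_int f) :: 'a poly)"
  by (auto intro!: poly_eqI simp: coeff_map_poly coeff_pCons split: nat.split)

lemma of_Zq_0 [simp]: "of_Zq 0 = 0" and of_Zq_1 [simp]: "of_Zq 1 = 1"
  and of_Zq_add: "of_Zq (f + g) = of_Zq f + of_Zq g"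
  and of_Zq_diff: "of_Zq (f - g) = of_Zq f - of_Zq g"
  by (simp_all add: of_Zq_def map_poly_of_int_simps)

lemma of_Zq_eq_0_iff [simp]: "of_Zq f = 0 \<longleftrightarrow> f = 0"
  using of_Zq_eq_iff[of f 0] by simp

lemma of_Zq_qvar: "of_Zq [:0, 1:] = qvar"
  by (simp add: of_Zq_def qvar_def map_poly_of_int_simps)

lemma of_Zq_const: "of_Zq [:a:] = of_int a"
proof -
  have "of_Zq (of_nat n) = of_nat n" for n
    by (induction n) (simp_all add: of_Zq_add)
  then have "of_Zq (of_int a) = of_int a"
    by (cases a rule: int_diff_cases) (simp add: of_Zq_diff)
  then show ?thesis by (simp add: of_int_poly)
qed

lemma of_Zq_pCons: "of_Zq (pCons a f) = of_int a + qvar * of_Zq f"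
proof -
  have "pCons a f = [:a:] + [:0, 1:] * f" by simp
  then show ?thesis
    by (simp only: of_Zq_add of_Zq_mult of_Zq_const of_Zq_qvar)
qed

lemma subring_Zq: "subring_set Zq"
  by (intro subring_setI)
    (auto simp: Zq_def simp flip: of_Zq_1 of_Zq_diff of_Zq_mult)

lemma of_Zq_in_Zq [simp]: "of_Zq f \<in> Zq"
  by (simp add: Zq_def)

lemma qvar_in_Zq [simp]: "qvar \<in> Zq"
  by (simp flip: of_Zq_qvar)

text \<open>
  The localisation of \<open>\<int>[q]\<close> at the prime ideal of the polynomials that vanish at \<open>\<kappa>\<close>. In positive
  characteristic \<open>p\<close>, already \<open>1/p\<close> is not regular.
\<close>

definition regular_at :: "'k::field \<Rightarrow> rat poly fract set" where
  "regular_at \<kappa> = {of_Zq f / of_Zq g | f g. poly (map_poly of_int g) \<kappa> \<noteq> 0}"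

lemma regular_atE:
  assumes "r \<in> regular_at \<kappa>"
  obtains f g where "r = of_Zq f / of_Zq g" "poly (map_poly of_int g) \<kappa> \<noteq> 0" "g \<noteq> 0"
    "q_eval \<kappa> r = poly (map_poly of_int f) \<kappa> / poly (map_poly of_int g) \<kappa>"
  using assms q_eval_eqI unfolding regular_at_def by fastforce

lemma regular_at_divide:
  "poly (map_poly of_int g) \<kappa> \<noteq> 0 \<Longrightarrow> of_Zq f / of_Zq g \<in> regular_at \<kappa>"
  by (auto simp: regular_at_def)

lemma q_eval_of_Zq [simp]: "q_eval \<kappa> (of_Zq f) = poly (map_poly of_int f) \<kappa>"
  using q_eval_eqI[of 1 \<kappa> f] by simp

lemma q_eval_hom_regular_at: "subring_hom (regular_at \<kappa>) (q_eval \<kappa>)"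
proof
  show "subring_set (regular_at \<kappa>)"
  proof (rule subring_setI)
    show "1 \<in> regular_at \<kappa>"
      using regular_at_divide[of 1 \<kappa> 1] by simp
  next
    fix a b assume "a \<in> regular_at \<kappa>" "b \<in> regular_at \<kappa>"
    then obtain f g f' g' where *: "a = of_Zq f / of_Zq g" "poly (map_poly of_int g) \<kappa> \<noteq> 0" "g \<noteq> 0"
      "b = of_Zq f' / of_Zq g'" "poly (map_poly of_int g') \<kappa> \<noteq> 0" "g' \<noteq> 0"
      by (elim regular_atE)
    have "a - b = of_Zq (f * g' - f' * g) / of_Zq (g * g')" "a * b = of_Zq (f * f') / of_Zq (g * g')"
      using * by (simp_all add: of_Zq_diff of_Zq_mult diff_frac_eq)
    moreover have "poly (map_poly of_int (g * g')) \<kappa> \<noteq> 0"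
      using * by (simp add: poly_map_of_int_mult)
    ultimately show "a - b \<in> regular_at \<kappa>" "a * b \<in> regular_at \<kappa>"
      using regular_at_divide by metis+
  qed
  show "q_eval \<kappa> 1 = 1"
    using q_eval_of_Zq[of \<kappa> 1] by simp
next
  fix a b assume "a \<in> regular_at \<kappa>" "b \<in> regular_at \<kappa>"
  then obtain f g f' g' where *: "a = of_Zq f / of_Zq g" "poly (map_poly of_int g) \<kappa> \<noteq> 0" "g \<noteq> 0"
    "q_eval \<kappa> a = poly (map_poly of_int f) \<kappa> / poly (map_poly of_int g) \<kappa>"
    "b = of_Zq f' / of_Zq g'" "poly (map_poly of_int g') \<kappa> \<noteq> 0" "g' \<noteq> 0"
    "q_eval \<kappa> b = poly (map_poly of_int f') \<kappa> / poly (map_poly of_int g') \<kappa>"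
    by (elim regular_atE)
  have ab: "a + b = of_Zq (f * g' + f' * g) / of_Zq (g * g')" "a * b = of_Zq (f * f') / of_Zq (g * g')"
    using * by (simp_all add: of_Zq_add of_Zq_mult add_frac_eq)
  have nz: "poly (map_poly of_int (g * g')) \<kappa> \<noteq> 0"
    using * by (simp add: poly_map_of_int_mult)
  show "q_eval \<kappa> (a + b) = q_eval \<kappa> a + q_eval \<kappa> b"
    unfolding ab q_eval_eqI[OF nz]
    using * by (simp add: poly_map_of_int_mult map_poly_of_int_simps add_frac_eq)
  show "q_eval \<kappa> (a * b) = q_eval \<kappa> a * q_eval \<kappa> b"
    unfolding ab q_eval_eqI[OF nz] using * by (simp add: poly_map_of_int_mult)
qed

lemma Zq_regular_at: "Zq \<subseteq> regular_at \<kappa>"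
  using regular_at_divide[of 1 \<kappa>] by (auto simp: Zq_def)

lemma q_eval_hom_Zq: "subring_hom Zq (q_eval \<kappa>)"
proof -
  interpret subring_hom "regular_at \<kappa>" "q_eval \<kappa>" by (rule q_eval_hom_regular_at)
  show ?thesis
    using Zq_regular_at[of \<kappa>] subring_Zq by unfold_locales (auto simp: hom_one hom_add hom_mult subset_iff)
qed

lemma q_eval_0 [simp]: "q_eval \<kappa> 0 = 0" and q_eval_1 [simp]: "q_eval \<kappa> 1 = 1"
  using subring_hom.hom_zero[OF q_eval_hom_Zq] subring_hom.hom_one[OF q_eval_hom_Zq] by auto

lemma q_eval_qvar [simp]: "q_eval \<kappa> qvar = \<kappa>"
  using q_eval_of_Zq[of \<kappa> "[:0, 1:]"] by (simp add: of_Zq_qvar map_poly_of_int_simps)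

lemma qbinomial_in_Zq [simp]: "qbinomial qvar n k \<in> Zq"
  by (simp add: subring_qbinomial subring_Zq)

lemma q_eval_qbinomial: "q_eval \<kappa> (qbinomial qvar n k) = qbinomial \<kappa> n k"
  using subring_hom.hom_qbinomial[OF q_eval_hom_Zq, of qvar] by simp

lemma q_eval_gauss_binom: "q_eval \<kappa> (gauss_binom n k) = qbinomial \<kappa> n k"
  by (simp add: gauss_binom_eq q_eval_qbinomial)

section \<open>Coordinates with respect to the \<open>q\<close>-binomial coefficient polynomials\<close>

lemma subring_Rq_plus: "subring_set Rq_plus"
  unfolding Rq_plus_def by (rule subring_set_preimage_poly[OF subring_Zq])

lemma poly_at_nat_in_Zq: "P \<in> Rq_plus \<Longrightarrow> poly P (q_int (int n)) \<in> Zq"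
  by (simp add: Rq_plus_def)

lemma const_in_Rq_plus: "c \<in> Zq \<Longrightarrow> [:c:] \<in> Rq_plus"
  by (simp add: Rq_plus_def)

lemma q_binom_poly_in_Rq_plus [simp]: "q_binom_poly k \<in> Rq_plus"
  by (simp add: Rq_plus_def q_binom_poly_at_nat)

text \<open>
  Solves \<open>P([n]\<^sub>q) = \<Sum>\<^bsub>k \<le> n\<^esub> coord P k \<cdot> B\<^sub>k([n]\<^sub>q)\<close> for \<open>n = 0, 1, 2, \<dots>\<close>; no division occurs since
  the diagonal entries \<open>B\<^sub>n([n]\<^sub>q)\<close> are \<open>1\<close>.
\<close>

function coord :: "rat poly fract poly \<Rightarrow> nat \<Rightarrow> rat poly fract" where
  "coord P n = poly P (q_int (int n)) - (\<Sum>k<n. coord P k * qbinomial qvar n k)"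
  by auto
termination by (relation "measure snd") auto

declare coord.simps [simp del]

lemma poly_at_nat_coord: "poly P (q_int (int n)) = (\<Sum>k\<le>n. coord P k * qbinomial qvar n k)"
  using coord.simps[of P n] by (simp flip: lessThan_Suc_atMost)

lemma poly_at_nat_coord_le:
  assumes "n \<le> M"
  shows "poly P (q_int (int n)) = (\<Sum>k\<le>M. coord P k * qbinomial qvar n k)"
  unfolding poly_at_nat_coord using assms
  by (intro sum.mono_neutral_left) (auto simp: qbinomial_eq_0)

lemma coord_in_Zq: "P \<in> Rq_plus \<Longrightarrow> coord P n \<in> Zq"
proof (induction n rule: less_induct)
  case (less n)
  then have "poly P (q_int (int n)) \<in> Zq" by (simp add: Rq_plus_def)
  then show ?case
    using less unfolding coord.simps[of P n]
    by (intro subring_diff subring_sum subring_mult subring_Zq) auto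
qed

lemma coord_add: "coord (P + Q) n = coord P n + coord Q n"
proof (induction n rule: less_induct)
  case (less n)
  then show ?case
    by (simp add: coord.simps[of "P + Q" n] coord.simps[of P n] coord.simps[of Q n]
        sum.distrib algebra_simps)
qed

lemma coord_smult: "coord (smult c P) n = c * coord P n"
proof (induction n rule: less_induct)
  case (less n)
  then show ?case
    by (simp add: coord.simps[of "smult c P" n] coord.simps[of P n] sum_distrib_left algebra_simps)
qed

lemma coord_q_binom_poly: "coord (q_binom_poly m) n = (if n = m then 1 else 0)"
proof (induction n rule: less_induct)
  case (less n)
  have "(\<Sum>k<n. coord (q_binom_poly m) k * qbinomial qvar n k) =
      (\<Sum>k<n. if m = k then qbinomial qvar n k else 0)"
    using less by (intro sum.cong) auto
  then show ?case
    by (auto simp: coord.simps[of _ n] q_binom_poly_at_nat qbinomial_eq_0)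
qed

lemma degree_q_binom_poly_le: "degree (q_binom_poly k) \<le> k"
proof -
  have "degree (\<Prod>i<k. [:- q_int (int i), 1:]) \<le> (\<Sum>i<k. degree [:- q_int (int i), 1:])"
    using degree_prod_sum_le[of "{..<k}" "\<lambda>i. [:- q_int (int i), 1:]"] by (simp add: o_def)
  then show ?thesis
    using degree_smult_le unfolding q_binom_poly_def by fastforce
qed

text \<open>
  Both sides have degree at most \<open>M\<close>, and they agree at the \<open>M + 1\<close> distinct points \<open>[0]\<^sub>q, \<dots>, [M]\<^sub>q\<close> by
  the choice of the coordinates.
\<close>

lemma coord_expansion:
  assumes "degree P \<le> M"
  shows "P = (\<Sum>k\<le>M. smult (coord P k) (q_binom_poly k))" (is "_ = ?S")
proof (rule poly_eqI_degree)
  let ?A = "(\<lambda>n. q_int (int n)) ` {..M}"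
  show "poly P x = poly ?S x" if "x \<in> ?A" for x
    using that poly_at_nat_coord_le[of _ M P] by (auto simp: poly_sum q_binom_poly_at_nat)
  have "card ?A = Suc M"
    by (subst card_image) (auto simp: inj_on_def)
  moreover have "degree ?S \<le> M"
    using degree_q_binom_poly_le by (intro degree_sum_le) (auto intro: order.trans[OF degree_smult_le] le_trans)
  ultimately show "card ?A > degree P" "card ?A > degree ?S"
    using assms by auto
qed

lemma coord_expansion_const: "(\<Sum>l\<le>degree P. [:coord P l:] * q_binom_poly l) = P"
  by (rule trans[OF _ coord_expansion[OF order_refl, symmetric]]) simp

text \<open>
  The expansions up to \<open>k - 1\<close> and up to \<open>k\<close> both represent \<open>P\<close>, so their difference, the \<open>k\<close>-th term, is
  zero.
\<close>

lemma coord_eq_0: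
  assumes "degree P < k"
  shows "coord P k = 0"
proof -
  obtain j where j: "k = Suc j" "degree P \<le> j" using assms by (cases k) auto
  have "smult (coord P k) (q_binom_poly k) = 0"
    using coord_expansion[of P j] coord_expansion[of P "Suc j"] j by simp
  moreover have "poly (q_binom_poly k) (q_int (int k)) \<noteq> 0"
    by (simp add: q_binom_poly_at_nat)
  ultimately show ?thesis by auto
qed

section \<open>Families of values that define a homomorphism\<close>

text \<open>
  The only possible homomorphism that maps \<open>q\<close> to \<open>\<kappa>\<close> and \<open>B\<^sub>m\<close> to \<open>b m\<close>; it is always additive, but
  multiplicative only for special \<open>b\<close>.
\<close>

definition hom_of :: "'k::field \<Rightarrow> (nat \<Rightarrow> 'k) \<Rightarrow> rat poly fract poly \<Rightarrow> 'k" where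
  "hom_of \<kappa> b P = (\<Sum>l\<le>degree P. q_eval \<kappa> (coord P l) * b l)"

lemma hom_of_eq:
  assumes "degree P \<le> M"
  shows "hom_of \<kappa> b P = (\<Sum>l\<le>M. q_eval \<kappa> (coord P l) * b l)"
  unfolding hom_of_def using assms
  by (intro sum.mono_neutral_left) (auto simp: coord_eq_0)

lemma hom_of_add:
  assumes "P \<in> Rq_plus" "Q \<in> Rq_plus"
  shows "hom_of \<kappa> b (P + Q) = hom_of \<kappa> b P + hom_of \<kappa> b Q"
proof -
  define M where "M = max (degree P) (degree Q)"
  have "degree (P + Q) \<le> M" "degree P \<le> M" "degree Q \<le> M"
    by (auto simp: M_def degree_add_le_max)
  moreover have "q_eval \<kappa> (coord (P + Q) l) = q_eval \<kappa> (coord P l) + q_eval \<kappa> (coord Q l)" for l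
    using assms by (simp add: coord_add subring_hom.hom_add[OF q_eval_hom_Zq] coord_in_Zq)
  ultimately show ?thesis
    by (simp add: hom_of_eq distrib_right sum.distrib)
qed

text \<open>
  Here the linear map is an evaluation, hence multiplicative. All other admissible families are obtained
  from these.
\<close>

lemma hom_of_qbinomial:
  assumes "P \<in> Rq_plus"
  shows "hom_of \<kappa> (qbinomial \<kappa> n) P = q_eval \<kappa> (poly P (q_int (int n)))"
proof -
  interpret subring_hom Zq "q_eval \<kappa>" by (rule q_eval_hom_Zq)
  define M where "M = max n (degree P)"
  have "q_eval \<kappa> (poly P (q_int (int n))) = (\<Sum>l\<le>M. q_eval \<kappa> (coord P l * qbinomial qvar n l))"
    using assms poly_at_nat_coord_le[of n M P]
    by (simp add: M_def hom_sum subring_mult[OF subring_Zq] coord_in_Zq)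
  also have "\<dots> = hom_of \<kappa> (qbinomial \<kappa> n) P"
    using assms by (simp add: hom_of_eq[of P M] M_def hom_mult coord_in_Zq q_eval_qbinomial)
  finally show ?thesis by simp
qed

lemma hom_of_q_binom_poly: "hom_of \<kappa> b (q_binom_poly m) = b m"
proof -
  have "hom_of \<kappa> b (q_binom_poly m) = (\<Sum>l\<le>m. if m = l then b l else 0)"
    unfolding hom_of_eq[OF degree_q_binom_poly_le]
    by (intro sum.cong) (auto simp: coord_q_binom_poly)
  then show ?thesis by simp
qed

lemma hom_of_const: "hom_of \<kappa> b [:c:] = q_eval \<kappa> c * b 0"
proof -
  have "coord [:c:] 0 = c"
    using coord_smult[of c "q_binom_poly 0" 0] coord_q_binom_poly[of 0 0] by simp
  then show ?thesis by (simp add: hom_of_def)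
qed

definition admissible :: "'k::field \<Rightarrow> (nat \<Rightarrow> 'k) \<Rightarrow> bool" where
  "admissible \<kappa> b \<longleftrightarrow> b 0 = 1 \<and>
     (\<forall>P\<in>Rq_plus. \<forall>Q\<in>Rq_plus. hom_of \<kappa> b (P * Q) = hom_of \<kappa> b P * hom_of \<kappa> b Q)"

lemma admissible_qbinomial: "admissible \<kappa> (qbinomial \<kappa> n)"
proof -
  have "hom_of \<kappa> (qbinomial \<kappa> n) (P * Q) = hom_of \<kappa> (qbinomial \<kappa> n) P * hom_of \<kappa> (qbinomial \<kappa> n) Q"
    if "P \<in> Rq_plus" "Q \<in> Rq_plus" for P Q
    using that subring_mult[OF subring_Rq_plus that] subring_hom.hom_mult[OF q_eval_hom_Zq[of \<kappa>]]
    by (simp add: hom_of_qbinomial Rq_plus_def)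
  then show ?thesis by (simp add: admissible_def)
qed

text \<open>
  For given \<open>P\<close> and \<open>Q\<close>, only the values up to the degree of \<open>P * Q\<close> enter.
\<close>

lemma admissible_limit:
  assumes "\<And>M. \<exists>b'. admissible \<kappa> b' \<and> (\<forall>m\<le>M. b m = b' m)"
  shows "admissible \<kappa> b"
proof -
  have "hom_of \<kappa> b (P * Q) = hom_of \<kappa> b P * hom_of \<kappa> b Q"
    if "P \<in> Rq_plus" "Q \<in> Rq_plus" for P Q
  proof -
    define M where "M = degree P + degree Q"
    obtain b' where b': "admissible \<kappa> b'" "\<And>m. m \<le> M \<Longrightarrow> b m = b' m"
      using assms by metis
    have "hom_of \<kappa> b T = hom_of \<kappa> b' T" if "degree T \<le> M" for T
      using that b'(2) by (simp add: hom_of_eq)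
    moreover have "degree P \<le> M" "degree Q \<le> M" "degree (P * Q) \<le> M"
      by (auto simp: M_def degree_mult_le)
    ultimately show ?thesis
      using b'(1) that by (simp add: admissible_def)
  qed
  moreover have "b 0 = 1"
    using assms[of 0] by (auto simp: admissible_def)
  ultimately show ?thesis by (simp add: admissible_def)
qed

lemma poly_eq_of_infinite:
  fixes p r :: "'a::idom poly"
  assumes "infinite T" "\<And>t. t \<in> T \<Longrightarrow> poly p t = poly r t"
  shows "p = r"
proof (rule ccontr)
  assume "p \<noteq> r"
  then have "finite {t. poly (p - r) t = 0}" by (intro poly_roots_finite) simp
  moreover have "T \<subseteq> {t. poly (p - r) t = 0}" using assms(2) by auto
  ultimately show False using assms(1) finite_subset by blast
qed

text \<open>
  For given \<open>P\<close> and \<open>Q\<close>, both sides of the multiplicativity are polynomials in the parameter \<open>t\<close>.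
\<close>

lemma admissible_interpolation:
  fixes F :: "nat \<Rightarrow> 'k::field poly"
  assumes T: "infinite T" and adm: "\<And>t. t \<in> T \<Longrightarrow> admissible \<kappa> (\<lambda>m. poly (F m) t)"
  shows "admissible \<kappa> (\<lambda>m. poly (F m) t)"
proof -
  define H where "H P = (\<Sum>l\<le>degree P. smult (q_eval \<kappa> (coord P l)) (F l))" for P
  have H: "poly (H P) t = hom_of \<kappa> (\<lambda>m. poly (F m) t) P" for P t
    by (simp add: H_def hom_of_def poly_sum)
  have "H (P * Q) = H P * H Q" if "P \<in> Rq_plus" "Q \<in> Rq_plus" for P Q
    using adm that by (intro poly_eq_of_infinite[OF T]) (simp add: H admissible_def)
  moreover have "F 0 = 1"
    using adm by (intro poly_eq_of_infinite[OF T]) (simp add: admissible_def)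
  ultimately show ?thesis
    unfolding admissible_def by (metis H poly_1 poly_mult)
qed

section \<open>Homomorphisms and their values\<close>

lemma ring_homs_iff:
  "subring_set R \<Longrightarrow> \<phi> \<in> ring_homs R \<longleftrightarrow> \<phi> \<in> extensional R \<and> subring_hom R \<phi>"
  by (auto simp: ring_homs_def subring_hom_def)

text \<open>
  The subring generated by \<open>q\<close> is \<open>\<int>[q]\<close>, on which the image of \<open>q\<close> determines a homomorphism.
\<close>

lemma hom_const:
  assumes "subring_hom Rq_plus \<phi>" "c \<in> Zq"
  shows "\<phi> [:c:] = q_eval (\<phi> [:qvar:]) (c :: rat poly fract)"
proof -
  interpret subring_hom Rq_plus \<phi> by fact
  have "\<phi> [:of_Zq f:] = q_eval (\<phi> [:qvar:]) (of_Zq f)" for f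
  proof (induction f)
    case (pCons a f)
    have "[:of_Zq (pCons a f):] = of_int a + [:qvar:] * [:of_Zq f:]"
      by (simp add: of_Zq_pCons of_int_poly)
    moreover have "[:of_Zq f:] \<in> Rq_plus" "[:qvar:] \<in> Rq_plus"
      by (simp_all add: const_in_Rq_plus)
    ultimately have "\<phi> [:of_Zq (pCons a f):] = of_int a + \<phi> [:qvar:] * \<phi> [:of_Zq f:]"
      using subring_of_int[OF subring, of a] subring_mult[OF subring]
      by (simp only: hom_add hom_mult hom_of_int)
    then show ?case using pCons by (simp add: map_poly_of_int_simps)
  qed (simp add: hom_zero)
  then show ?thesis using assms(2) by (auto simp: Zq_def)
qed

lemma hom_eq_hom_of:
  assumes "subring_hom Rq_plus \<phi>" "P \<in> Rq_plus"
  shows "\<phi> P = hom_of (\<phi> [:qvar:]) (\<lambda>m. \<phi> (q_binom_poly m)) P"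
proof -
  interpret subring_hom Rq_plus \<phi> by fact
  have c: "[:coord P l:] \<in> Rq_plus" for l
    using assms(2) by (simp add: const_in_Rq_plus coord_in_Zq)
  have "\<phi> P = \<phi> (\<Sum>l\<le>degree P. [:coord P l:] * q_binom_poly l)"
    by (simp only: coord_expansion_const)
  also have "\<dots> = (\<Sum>l\<le>degree P. \<phi> [:coord P l:] * \<phi> (q_binom_poly l))"
    using c subring_mult[OF subring c] by (simp only: hom_sum hom_mult q_binom_poly_in_Rq_plus)
  also have "\<dots> = hom_of (\<phi> [:qvar:]) (\<lambda>m. \<phi> (q_binom_poly m)) P"
    unfolding hom_of_def using hom_const[OF assms(1) coord_in_Zq[OF assms(2)]]
    by (intro sum.cong) simp_all
  finally show ?thesis .
qed

lemma ex1_ring_hom: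
  assumes "admissible \<kappa> b"
  shows "\<exists>!\<phi>. \<phi> \<in> ring_homs Rq_plus \<and> has_values \<phi> \<kappa> b"
proof (rule ex1I[of _ "restrict (hom_of \<kappa> b) Rq_plus"])
  have "[:qvar:] \<in> Rq_plus" by (simp add: const_in_Rq_plus)
  moreover have b0: "b 0 = 1" using assms by (simp add: admissible_def)
  moreover have "hom_of \<kappa> b 1 = 1"
    using hom_of_const[of \<kappa> b 1] b0 by (simp add: one_pCons)
  ultimately show "restrict (hom_of \<kappa> b) Rq_plus \<in> ring_homs Rq_plus \<and>
      has_values (restrict (hom_of \<kappa> b) Rq_plus) \<kappa> b"
    using subring_Rq_plus assms
    by (simp add: ring_homs_def has_values_def subring_one subring_add subring_mult
        hom_of_add hom_of_q_binom_poly hom_of_const admissible_def)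
next
  fix \<psi> assume \<psi>: "\<psi> \<in> ring_homs Rq_plus \<and> has_values \<psi> \<kappa> b"
  then have "subring_hom Rq_plus \<psi>" "\<psi> \<in> extensional Rq_plus"
    by (auto simp: ring_homs_iff subring_Rq_plus)
  moreover have "\<psi> [:qvar:] = \<kappa>" "(\<lambda>m. \<psi> (q_binom_poly m)) = b"
    using \<psi> by (auto simp: has_values_def)
  ultimately have "\<psi> P = hom_of \<kappa> b P" if "P \<in> Rq_plus" for P
    using hom_eq_hom_of[of \<psi> P] that by metis
  then show "\<psi> = restrict (hom_of \<kappa> b) Rq_plus"
    using \<open>\<psi> \<in> extensional Rq_plus\<close> by (auto simp: extensional_def fun_eq_iff)
qed

text \<open>
  The triangular recursion for the coordinates is preserved by specialising \<open>q\<close>. Hence, if all values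
  \<open>P([n]\<^sub>q)\<close> specialise to zero, so do all coordinates. This transfers every algebraic relation that holds
  for the Gaussian binomial coefficients of all \<open>n\<close> to the values of an arbitrary homomorphism.
\<close>

lemma hom_eq_0:
  assumes "subring_hom Rq_plus \<phi>" and P: "P \<in> Rq_plus"
    and "\<And>n. q_eval (\<phi> [:qvar:]) (poly P (q_int (int n))) = 0"
  shows "\<phi> P = 0"
proof -
  define \<kappa> where "\<kappa> = \<phi> [:qvar:]"
  interpret ev: subring_hom Zq "q_eval \<kappa>" by (rule q_eval_hom_Zq)
  have "q_eval \<kappa> (coord P n) = 0" for n
  proof (induction n rule: less_induct)
    case (less n)
    have "poly P (q_int (int n)) \<in> Zq" using P by (simp add: Rq_plus_def)
    then show ?case
      unfolding coord.simps[of P n] using less assms(3)[of n] P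
      by (simp add: ev.hom_diff ev.hom_sum ev.hom_mult subring_sum subring_mult subring_Zq coord_in_Zq
          flip: \<kappa>_def)
  qed
  then show ?thesis
    unfolding hom_eq_hom_of[OF assms(1) P] hom_of_def \<kappa>_def by simp
qed

text \<open>
  A compactness argument. Suppose that for each of the finitely many possible value vectors the
  homomorphism deviates at some index. Then the product of the corresponding differences vanishes at
  each \<open>n\<close>, because \<open>n\<close> realises one of the vectors, and is mapped to zero, although \<open>\<phi>\<close> maps none of its
  factors to zero.
\<close>

lemma finite_approximation:
  fixes \<phi> :: "rat poly fract poly \<Rightarrow> 'k::field"
  assumes "subring_hom Rq_plus \<phi>" and \<kappa>: "\<phi> [:qvar:] = \<kappa>" and "finite A"
    and fin: "\<And>m. m \<in> A \<Longrightarrow> finite (range (\<lambda>n. qbinomial \<kappa> n m))"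
  obtains n where "\<And>m. m \<in> A \<Longrightarrow> \<phi> (q_binom_poly m) = qbinomial \<kappa> n m"
proof -
  interpret subring_hom Rq_plus \<phi> by fact
  interpret ev: subring_hom Zq "q_eval \<kappa>" by (rule q_eval_hom_Zq)
  define v where "v n = restrict (\<lambda>m. qbinomial \<kappa> n m) A" for n
  have "range v \<subseteq> (\<Pi>\<^sub>E m\<in>A. range (\<lambda>n. qbinomial \<kappa> n m))"
    by (auto simp: v_def)
  moreover have "finite (\<Pi>\<^sub>E m\<in>A. range (\<lambda>n. qbinomial \<kappa> n m))"
    using \<open>finite A\<close> fin by (rule finite_PiE)
  ultimately have "finite (range v)"
    by (rule finite_subset)
  \<comment> \<open>One \<open>n\<close> for each value vector is enough, so that the product below can be taken finite.\<close>
  from finite_subset_image[OF this order_refl] obtain S where S: "finite S" "range v = v ` S"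
    by blast
  have "\<exists>n. \<forall>m\<in>A. \<phi> (q_binom_poly m) = qbinomial \<kappa> n m"
  proof (rule ccontr)
    assume "\<not> ?thesis"
    then obtain \<mu> where \<mu>: "\<And>n. \<mu> n \<in> A" "\<And>n. \<phi> (q_binom_poly (\<mu> n)) \<noteq> qbinomial \<kappa> n (\<mu> n)"
      by metis
    \<comment> \<open>The value to be subtracted is lifted from the field to \<open>\<int>[q]\<close>.\<close>
    define D where "D n = q_binom_poly (\<mu> n) - [:qbinomial qvar n (\<mu> n):]" for n
    have c: "[:qbinomial qvar n (\<mu> n):] \<in> Rq_plus" for n
      by (simp add: const_in_Rq_plus)
    then have D: "D n \<in> Rq_plus" for n
      by (simp add: D_def subring_diff subring)
    have "\<phi> (prod D S) = 0"
    proof (rule hom_eq_0[OF assms(1)])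
      show "prod D S \<in> Rq_plus" using D by (rule subring_prod[OF subring])
    next
      fix n
      have "v n \<in> v ` S" unfolding S(2)[symmetric] by (rule rangeI)
      then obtain n' where n': "n' \<in> S" "v n' = v n" by (metis imageE)
      have "qbinomial \<kappa> n' (\<mu> n') = qbinomial \<kappa> n (\<mu> n')"
        using fun_cong[OF n'(2), of "\<mu> n'"] \<mu>(1) by (simp add: v_def)
      then have zero: "q_eval \<kappa> (poly (D n') (q_int (int n))) = 0"
        by (simp add: D_def q_binom_poly_at_nat ev.hom_diff q_eval_qbinomial)
      moreover have "poly (D m) (q_int (int n)) \<in> Zq" for m
        using D by (auto simp: Rq_plus_def)
      ultimately show "q_eval (\<phi> [:qvar:]) (poly (prod D S) (q_int (int n))) = 0"
        unfolding \<kappa> poly_prod using S(1) n'(1) zero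
        by (subst ev.hom_prod) (auto intro: prod_zero)
    qed
    moreover have "\<phi> (D n) \<noteq> 0" for n
    proof -
      have "\<phi> [:qbinomial qvar n (\<mu> n):] = qbinomial \<kappa> n (\<mu> n)"
        unfolding hom_const[OF assms(1) qbinomial_in_Zq] \<kappa> by (rule q_eval_qbinomial)
      then show ?thesis
        using \<mu>(2)[of n] hom_diff[OF q_binom_poly_in_Rq_plus c] by (simp add: D_def)
    qed
    ultimately show False
      using S(1) D by (simp add: hom_prod)
  qed
  then show thesis using that by blast
qed

section \<open>Inverting \<open>q\<close>\<close>

lemma Zq_laurentI: "f \<in> Zq \<Longrightarrow> f / qvar ^ k \<in> Zq_laurent"
  by (auto simp: Zq_laurent_def Zq_def)

lemma Zq_subset_laurent: "Zq \<subseteq> Zq_laurent"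
  using Zq_laurentI[of _ 0] by auto

lemma Zq_laurent_iff: "r \<in> Zq_laurent \<longleftrightarrow> (\<exists>k. qvar ^ k * r \<in> Zq)"
proof
  assume "r \<in> Zq_laurent"
  then obtain f k where "r = of_Zq f / qvar ^ k" by (auto simp: Zq_laurent_def)
  then have "qvar ^ k * r \<in> Zq" by simp
  then show "\<exists>k. qvar ^ k * r \<in> Zq" ..
next
  assume "\<exists>k. qvar ^ k * r \<in> Zq"
  then obtain k where k: "qvar ^ k * r \<in> Zq" ..
  have "r = (qvar ^ k * r) / qvar ^ k" by simp
  then show "r \<in> Zq_laurent" using Zq_laurentI[OF k, of k] by simp
qed

lemma qvar_power_mult_in_Zq: "f \<in> Zq \<Longrightarrow> qvar ^ k * f \<in> Zq"
  by (simp add: subring_Zq subring_mult subring_power)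

lemma subring_Zq_laurent: "subring_set Zq_laurent"
proof (rule subring_setI)
  show "1 \<in> Zq_laurent" using Zq_subset_laurent subring_one[OF subring_Zq] by auto
next
  fix a b assume "a \<in> Zq_laurent" "b \<in> Zq_laurent"
  then obtain k l where kl: "qvar ^ k * a \<in> Zq" "qvar ^ l * b \<in> Zq"
    by (auto simp: Zq_laurent_iff)
  have "qvar ^ (k + l) * (a - b) = qvar ^ l * (qvar ^ k * a) - qvar ^ k * (qvar ^ l * b)"
    "qvar ^ (k + l) * (a * b) = (qvar ^ k * a) * (qvar ^ l * b)"
    by (simp_all add: power_add algebra_simps)
  then show "a - b \<in> Zq_laurent" "a * b \<in> Zq_laurent"
    using kl unfolding Zq_laurent_iff
    by (metis qvar_power_mult_in_Zq subring_diff[OF subring_Zq], metis subring_mult[OF subring_Zq])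
qed

lemma subring_Rq: "subring_set Rq"
  unfolding Rq_def by (rule subring_set_preimage_poly[OF subring_Zq_laurent])

text \<open>
  Solving the Pascal rule for its last term goes from \<open>[n + 1]\<^sub>q\<close> down to \<open>[n]\<^sub>q\<close> at the cost of a division
  by a power of \<open>q\<close>.
\<close>

lemma q_binom_poly_in_Rq: "q_binom_poly k \<in> Rq"
proof -
  have "poly (q_binom_poly k) (q_int (- int j)) \<in> Zq_laurent" for j k
  proof (induction j arbitrary: k)
    case 0
    show ?case using q_binom_poly_at_nat[of k 0] Zq_subset_laurent by auto
  next
    case (Suc j)
    show ?case
    proof (induction k)
      case 0
      show ?case by (simp add: subring_one[OF subring_Zq_laurent])
    next
      case (Suc k)
      let ?G = "\<lambda>k. poly (q_binom_poly k) (q_int (- int (Suc j)))"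
      have "poly (q_binom_poly (Suc k)) (q_int (- int j)) = ?G k + qvar ^ Suc k * ?G (Suc k)"
        using q_binom_poly_pascal[of k "- int (Suc j)"] by simp
      then have "qvar ^ Suc k * ?G (Suc k) \<in> Zq_laurent"
        using \<open>\<And>k. poly (q_binom_poly k) (q_int (- int j)) \<in> Zq_laurent\<close>[of "Suc k"] Suc.IH
          subring_diff[OF subring_Zq_laurent]
        by (metis add_diff_cancel_left')
      then show ?case
        unfolding Zq_laurent_iff[of "qvar ^ _ * _"] Zq_laurent_iff[of "poly _ _"]
        by (metis mult.assoc power_add)
    qed
  qed
  moreover have "poly (q_binom_poly k) (q_int (int j)) \<in> Zq_laurent" for j
    using Zq_subset_laurent by (auto simp: q_binom_poly_at_nat)
  ultimately show ?thesis
    unfolding Rq_def mem_Collect_eq by (metis int_cases2)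
qed

lemma const_in_Rq: "c \<in> Zq_laurent \<Longrightarrow> [:c:] \<in> Rq"
  by (simp add: Rq_def)

lemma Rq_plus_subset_Rq: "Rq_plus \<subseteq> Rq"
proof
  fix P assume P: "P \<in> Rq_plus"
  then have "(\<Sum>l\<le>degree P. [:coord P l:] * q_binom_poly l) \<in> Rq"
    using Zq_subset_laurent coord_in_Zq q_binom_poly_in_Rq
    by (intro subring_sum subring_mult subring_Rq const_in_Rq) auto
  then show "P \<in> Rq"
    by (simp only: coord_expansion_const)
qed

text \<open>
  The values at \<open>[n]\<^sub>q\<close> with \<open>n \<ge> 0\<close> already force the coordinates into \<open>\<int>[q, 1/q]\<close>, and there are only
  finitely many of them to clear of denominators.
\<close>

lemma Rq_denominator:
  assumes "P \<in> Rq"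
  obtains j where "[:qvar:] ^ j * P \<in> Rq_plus"
proof -
  have coord: "coord P n \<in> Zq_laurent" for n
  proof (induction n rule: less_induct)
    case (less n)
    have "poly P (q_int (int n)) \<in> Zq_laurent" using assms by (simp add: Rq_def)
    moreover have "qbinomial qvar n k \<in> Zq_laurent" for k
      using Zq_subset_laurent by auto
    ultimately show ?case
      using less unfolding coord.simps[of P n]
      by (intro subring_diff subring_sum subring_mult subring_Zq_laurent) auto
  qed
  have "\<exists>j. \<forall>l\<le>M. qvar ^ j * coord P l \<in> Zq" for M
  proof (induction M)
    case 0
    then show ?case using coord[of 0] by (simp add: Zq_laurent_iff)
  next
    case (Suc M)
    then obtain j where j: "\<And>l. l \<le> M \<Longrightarrow> qvar ^ j * coord P l \<in> Zq" by blast
    obtain i where i: "qvar ^ i * coord P (Suc M) \<in> Zq"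
      using coord Zq_laurent_iff by blast
    have "qvar ^ (i + j) * coord P l \<in> Zq" if "l \<le> Suc M" for l
    proof (cases "l = Suc M")
      case True
      then show ?thesis
        using qvar_power_mult_in_Zq[OF i, of j] by (simp add: power_add ac_simps)
    next
      case False
      then show ?thesis
        using qvar_power_mult_in_Zq[OF j, of l i] that by (simp add: power_add ac_simps)
    qed
    then show ?case by blast
  qed
  then obtain j where j: "\<And>l. l \<le> degree P \<Longrightarrow> qvar ^ j * coord P l \<in> Zq" by blast
  have q: "[:qvar:] ^ j * R = smult (qvar ^ j) R" for R
    by (simp add: poly_const_pow)
  have "[:qvar:] ^ j * P = [:qvar:] ^ j * (\<Sum>l\<le>degree P. [:coord P l:] * q_binom_poly l)"
    by (simp only: coord_expansion_const)
  also have "\<dots> = (\<Sum>l\<le>degree P. [:qvar ^ j * coord P l:] * q_binom_poly l)"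
    unfolding sum_distrib_left q by (simp add: mult.commute)
  also have "\<dots> \<in> Rq_plus"
    using j by (intro subring_sum[OF subring_Rq_plus] subring_mult[OF subring_Rq_plus] const_in_Rq_plus) auto
  finally show thesis using that by blast
qed

lemma Rq_hom_qvar_neq_0:
  fixes \<psi> :: "_ \<Rightarrow> 'k::field"
  assumes "\<psi> \<in> ring_homs Rq"
  shows "\<psi> [:qvar:] \<noteq> 0"
proof -
  have "[:qvar:] \<in> Rq" "[:1 / qvar:] \<in> Rq"
    using Zq_laurentI[OF qvar_in_Zq, of 0] Zq_laurentI[OF subring_one[OF subring_Zq], of 1]
    by (auto intro: const_in_Rq)
  then have "\<psi> ([:qvar:] * [:1 / qvar:]) = \<psi> [:qvar:] * \<psi> [:1 / qvar:]"
    using assms unfolding ring_homs_def by blast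
  moreover have "[:qvar:] * [:1 / qvar:] = 1" by (simp add: one_pCons)
  moreover have "\<psi> 1 = 1" using assms by (simp add: ring_homs_def)
  ultimately show ?thesis by (metis mult_zero_left zero_neq_one)
qed

lemma Rq_hom_restrict:
  assumes "\<psi> \<in> ring_homs Rq"
  shows "restrict \<psi> Rq_plus \<in> ring_homs Rq_plus"
    and "has_values (restrict \<psi> Rq_plus) \<kappa> b \<longleftrightarrow> has_values \<psi> \<kappa> b"
  using assms Rq_plus_subset_Rq subring_Rq_plus
  by (auto simp: ring_homs_def has_values_def subring_one subring_add subring_mult const_in_Rq_plus subset_iff)

text \<open>
  The universal property of the localisation: \<open>P\<close> is mapped to \<open>\<phi>(q\<^sup>j P) / \<kappa>\<^sup>j\<close> for any \<open>j\<close> that clears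
  its denominators.
\<close>

lemma ex1_ring_hom_Rq:
  fixes \<kappa> :: "'k::field"
  assumes ex1: "\<exists>!\<phi>. \<phi> \<in> ring_homs Rq_plus \<and> has_values \<phi> \<kappa> b" and \<kappa>: "\<kappa> \<noteq> 0"
  shows "\<exists>!\<psi>. \<psi> \<in> ring_homs Rq \<and> has_values \<psi> \<kappa> b"
proof -
  obtain \<phi> where \<phi>: "\<phi> \<in> ring_homs Rq_plus" "has_values \<phi> \<kappa> b" using ex1 by blast
  interpret subring_hom Rq_plus \<phi> using \<phi>(1) by (simp add: ring_homs_iff subring_Rq_plus)
  have q: "[:qvar:] \<in> Rq_plus" "\<phi> [:qvar:] = \<kappa>"
    using \<phi>(2) by (auto simp: const_in_Rq_plus has_values_def)
  have qpow: "[:qvar:] ^ i * P \<in> Rq_plus" "\<phi> ([:qvar:] ^ i * P) = \<kappa> ^ i * \<phi> P" if "P \<in> Rq_plus" for i P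
    using that q by (simp_all add: hom_mult hom_power subring_power subring_mult subring)
  define j where "j P = (SOME j. [:qvar:] ^ j * P \<in> Rq_plus)" for P
  have j: "[:qvar:] ^ j P * P \<in> Rq_plus" if "P \<in> Rq" for P
    unfolding j_def using Rq_denominator[OF that] by (metis someI_ex)
  define \<psi> where "\<psi> = restrict (\<lambda>P. \<phi> ([:qvar:] ^ j P * P) / \<kappa> ^ j P) Rq"
  have \<psi>: "\<psi> P = \<phi> ([:qvar:] ^ i * P) / \<kappa> ^ i" if "P \<in> Rq" "[:qvar:] ^ i * P \<in> Rq_plus" for P i
  proof -
    have "\<kappa> ^ i * \<phi> ([:qvar:] ^ j P * P) = \<phi> ([:qvar:] ^ i * ([:qvar:] ^ j P * P))"
      using qpow j[OF that(1)] by simp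
    also have "\<dots> = \<phi> ([:qvar:] ^ j P * ([:qvar:] ^ i * P))"
      by (simp only: ac_simps)
    also have "\<dots> = \<kappa> ^ j P * \<phi> ([:qvar:] ^ i * P)"
      using qpow that(2) by simp
    finally show ?thesis
      using \<kappa> that(1) by (simp add: \<psi>_def field_simps)
  qed
  have \<psi>_plus: "\<psi> P = \<phi> P" if "P \<in> Rq_plus" for P
    using \<psi>[of P 0] that Rq_plus_subset_Rq by auto
  have "\<psi> \<in> ring_homs Rq"
  proof -
    have "\<psi> (P + Q) = \<psi> P + \<psi> Q \<and> \<psi> (P * Q) = \<psi> P * \<psi> Q" if PQ: "P \<in> Rq" "Q \<in> Rq" for P Q
    proof -
      define P' Q' where "P' = [:qvar:] ^ j P * P" and "Q' = [:qvar:] ^ j Q * Q"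
      have PQ': "P' \<in> Rq_plus" "Q' \<in> Rq_plus" using j PQ by (auto simp: P'_def Q'_def)
      have sum: "[:qvar:] ^ (j P + j Q) * (P + Q) = [:qvar:] ^ j Q * P' + [:qvar:] ^ j P * Q'"
        and prod: "[:qvar:] ^ (j P + j Q) * (P * Q) = P' * Q'"
        unfolding P'_def Q'_def power_add by (simp_all only: algebra_simps)
      have mem: "[:qvar:] ^ (j P + j Q) * (P + Q) \<in> Rq_plus" "[:qvar:] ^ (j P + j Q) * (P * Q) \<in> Rq_plus"
        unfolding sum prod
        by (rule subring_add[OF subring qpow(1)[OF PQ'(1)] qpow(1)[OF PQ'(2)]])
          (rule subring_mult[OF subring PQ'])
      have "\<psi> P = \<phi> P' / \<kappa> ^ j P" "\<psi> Q = \<phi> Q' / \<kappa> ^ j Q"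
        using PQ by (simp_all add: \<psi>_def P'_def Q'_def)
      moreover have "\<psi> (P + Q) = (\<kappa> ^ j Q * \<phi> P' + \<kappa> ^ j P * \<phi> Q') / \<kappa> ^ (j P + j Q)"
        using \<psi>[OF subring_add[OF subring_Rq PQ] mem(1)] PQ' unfolding sum by (simp add: hom_add qpow)
      moreover have "\<psi> (P * Q) = (\<phi> P' * \<phi> Q') / \<kappa> ^ (j P + j Q)"
        using \<psi>[OF subring_mult[OF subring_Rq PQ] mem(2)] PQ' unfolding prod by (simp add: hom_mult)
      ultimately show ?thesis
        using \<kappa> by (simp add: power_add add_divide_distrib)
    qed
    moreover have "\<psi> 1 = 1"
      using \<psi>_plus[OF subring_one[OF subring]] hom_one by simp
    moreover have "\<psi> \<in> extensional Rq" by (simp add: \<psi>_def)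
    ultimately show ?thesis by (simp add: ring_homs_def)
  qed
  moreover have "has_values \<psi> \<kappa> b"
    using \<phi>(2) \<psi>_plus q(1) by (simp add: has_values_def)
  moreover have "\<psi>' = \<psi>" if \<psi>': "\<psi>' \<in> ring_homs Rq" "has_values \<psi>' \<kappa> b" for \<psi>'
  proof
    fix P
    interpret \<psi>': subring_hom Rq \<psi>' using \<psi>'(1) by (simp add: ring_homs_iff subring_Rq)
    have plus: "\<psi>' P = \<phi> P" if "P \<in> Rq_plus" for P
      using ex1 \<phi> Rq_hom_restrict[OF \<psi>'(1)] \<psi>'(2) that by (metis restrict_apply)
    show "\<psi>' P = \<psi> P"
    proof (cases "P \<in> Rq")
      case True
      have "[:qvar:] \<in> Rq" using q(1) Rq_plus_subset_Rq by auto
      then have "\<psi>' ([:qvar:] ^ j P * P) = \<kappa> ^ j P * \<psi>' P"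
        using True \<psi>'(2) by (simp add: \<psi>'.hom_mult \<psi>'.hom_power subring_power subring_Rq has_values_def)
      then show ?thesis
        using True \<kappa> plus[OF j[OF True]] by (simp add: \<psi>_def)
    next
      case False
      then show ?thesis using \<psi>'(1) by (simp add: ring_homs_def extensional_def \<psi>_def)
    qed
  qed
  ultimately show ?thesis by blast
qed

section \<open>Lucas congruences\<close>

lemma qnat_mult: "(q - 1) * qnat q n = q ^ n - (1::'a::comm_ring_1)"
  by (induction n) (simp_all add: qnat_Suc algebra_simps)

lemma primitive_root_qnat:
  fixes \<omega> :: "'k::field"
  assumes "primitive_root_of_unity d \<omega>" "0 < j" "j < d"
  shows "qnat \<omega> j \<noteq> 0" "qnat \<omega> d = 0"
proof -
  have "\<omega> ^ j \<noteq> 1" "\<omega> ^ d = 1" using assms by (auto simp: primitive_root_of_unity_def)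
  then show "qnat \<omega> j \<noteq> 0" "qnat \<omega> d = 0"
    using qnat_mult[of \<omega> j] qnat_mult[of \<omega> d] by auto
qed

text \<open>
  In row \<open>d\<close> the absorption identity has the factor \<open>[d]\<^sub>q\<close>, which vanishes at \<open>\<omega>\<close>, whereas \<open>[j]\<^sub>q\<close> does
  not for \<open>0 < j < d\<close>. For \<open>d = 1\<close> there is no such \<open>j\<close>.
\<close>

lemma qbinomial_at_root:
  fixes \<omega> :: "'k::field"
  assumes "primitive_root_of_unity d \<omega>"
  shows "qbinomial \<omega> n m = of_nat (n div d choose (m div d)) * qbinomial \<omega> (n mod d) (m mod d)"
proof (rule qbinomial_lucas)
  show "d > 0" "\<omega> ^ d = 1" using assms by (auto simp: primitive_root_of_unity_def)
  show "qbinomial \<omega> d j = 0" if "0 < j" "j < d" for j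
    using qbinomial_absorption[of \<omega> "j - 1" "d - 1"] primitive_root_qnat[OF assms that] that by simp
qed

lemma binomial_lucas_step:
  assumes p: "prime CHAR('k::field)"
  shows "(of_nat (n choose m) :: 'k) =
    of_nat (n div CHAR('k) choose (m div CHAR('k))) * of_nat (n mod CHAR('k) choose (m mod CHAR('k)))"
proof -
  have "qbinomial (1::'k) CHAR('k) j = 0" if "0 < j" "j < CHAR('k)" for j
    using dvd_choose_prime[of j "CHAR('k)"] that p by (simp add: qbinomial_at_1 of_nat_eq_0_iff_char_dvd)
  then show ?thesis
    using qbinomial_lucas[of "CHAR('k)" "1::'k" n m] p by (simp add: qbinomial_at_1 prime_gt_0_nat)
qed

lemma binomial_lucas_digits:
  assumes p: "prime CHAR('k::field)" and "m < CHAR('k) ^ r"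
  shows "(of_nat (n choose m) :: 'k) =
    (\<Prod>i<r. of_nat ((n div CHAR('k) ^ i mod CHAR('k)) choose (m div CHAR('k) ^ i mod CHAR('k))))"
  using assms(2)
proof (induction r arbitrary: n m)
  case (Suc r)
  have "m div CHAR('k) < CHAR('k) ^ r"
    using Suc.prems prime_gt_0_nat[OF p] by (simp add: less_mult_imp_div_less mult.commute)
  then show ?case
    unfolding binomial_lucas_step[OF p, of n m] prod.lessThan_Suc_shift
    by (simp add: Suc.IH div_mult2_eq mult.commute)
qed simp

text \<open>
  Modulo \<open>p\<close>, the binomial coefficient at \<open>p\<^sup>i\<close> reads off the \<open>i\<close>-th base \<open>p\<close> digit of \<open>n\<close>.
\<close>

lemma binomial_prime_power:
  assumes p: "prime CHAR('k::field)"
  shows "(of_nat (n choose CHAR('k) ^ i) :: 'k) = of_nat (n div CHAR('k) ^ i)"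
proof (induction i arbitrary: n)
  case (Suc i)
  then show ?case
    using prime_gt_0_nat[OF p] binomial_lucas_step[OF p, of n "CHAR('k) ^ Suc i"]
    by (simp add: div_mult2_eq)
qed simp

lemma digit_mod:
  fixes a p :: nat
  assumes "i < n"
  shows "(a mod p ^ n) div p ^ i mod p = a div p ^ i mod p"
proof -
  obtain k where n: "n = i + Suc k" using assms less_imp_add_positive by (metis Suc_pred)
  have "p ^ n = p ^ i * (p * p ^ k)" by (simp add: n power_add)
  then have "(a mod p ^ n) div p ^ i = a div p ^ i mod (p * p ^ k)"
    using assms by (cases "p = 0") (auto simp: mod_mult2_eq power_0_left)
  then show ?thesis by (simp add: mod_mod_cancel)
qed

text \<open>
  The \<open>p\<close>-adic continuity of binomial coefficients modulo \<open>p\<close>: only the digits of \<open>n\<close> at the positions of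
  digits of \<open>m\<close> matter.
\<close>

lemma binomial_mod_prime_power:
  assumes p: "prime CHAR('k::field)" and m: "m < CHAR('k) ^ r"
  shows "(of_nat ((n mod CHAR('k) ^ r) choose m) :: 'k) = of_nat (n choose m)"
  unfolding binomial_lucas_digits[OF assms] by (intro prod.cong) (simp_all add: digit_mod)

lemma mod_prime_power_eqI:
  assumes p: "prime CHAR('k::field)"
    and "\<And>j. j < i \<Longrightarrow> (of_nat (n choose CHAR('k) ^ j) :: 'k) = of_nat (n' choose CHAR('k) ^ j)"
  shows "n mod CHAR('k) ^ i = n' mod CHAR('k) ^ i"
  using assms(2)
proof (induction i)
  case (Suc i)
  have "(of_nat (n div CHAR('k) ^ i) :: 'k) = of_nat (n' div CHAR('k) ^ i)"
    using Suc.prems[of i] by (simp add: binomial_prime_power[OF p])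
  then have "n div CHAR('k) ^ i mod CHAR('k) = n' div CHAR('k) ^ i mod CHAR('k)"
    by (simp add: of_nat_eq_iff_cong_CHAR cong_def)
  moreover have "a mod CHAR('k) ^ Suc i = CHAR('k) ^ i * (a div CHAR('k) ^ i mod CHAR('k)) + a mod CHAR('k) ^ i" for a
    by (metis mod_mult2_eq power_Suc2)
  ultimately show ?case using Suc by simp
qed simp

section \<open>Binomial coefficients of \<open>p\<close>-adic integers\<close>

lemma padic_ints_mod:
  assumes "s \<in> padic_ints p" "i \<le> n"
  shows "s n mod int p ^ i = s i"
  using assms(2)
proof (induction n rule: dec_induct)
  case base
  then show ?case using assms(1) by (simp add: padic_ints_def)
next
  case (step n)
  have "s (Suc n) mod int p ^ i = (s (Suc n) mod int p ^ n) mod int p ^ i"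
    using step by (simp add: mod_mod_cancel le_imp_power_dvd)
  then show ?case using step assms(1) by (simp add: padic_ints_def)
qed

lemma padic_digit_eq:
  assumes s: "s \<in> padic_ints p" and p: "p > 0" and "i < n"
  shows "padic_digit p s i = nat (s n) div p ^ i mod p"
proof -
  define S where "S = nat (s n)"
  have S: "s n = int S" using s by (simp add: S_def padic_ints_def)
  have "s (Suc i) = int (S mod p ^ Suc i)"
    using padic_ints_mod[OF s, of "Suc i" n] \<open>i < n\<close> S by (simp add: zmod_int)
  then have "padic_digit p s i = (S mod p ^ Suc i) div p ^ i"
    unfolding padic_digit_def by (metis nat_int of_nat_power zdiv_int)
  also have "\<dots> = (S mod p ^ Suc i) div p ^ i mod p"
    using p by (simp add: less_mult_imp_div_less mult.commute)
  also have "\<dots> = S div p ^ i mod p" by (rule digit_mod) simp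
  finally show ?thesis by (simp add: S_def)
qed

text \<open>
  Digitwise, binomial coefficients of a \<open>p\<close>-adic integer are eventually those of its residues, which are
  natural numbers. This makes limits of Gaussian binomial coefficients available.
\<close>

lemma padic_binom_eq:
  assumes p: "prime CHAR('k::field)" and s: "s \<in> padic_ints CHAR('k)" and m: "m < CHAR('k) ^ n"
  shows "(of_nat (padic_binom CHAR('k) s m) :: 'k) = of_nat (nat (s n) choose m)"
proof -
  let ?p = "CHAR('k)"
  let ?f = "\<lambda>i. padic_digit ?p s i choose (m div ?p ^ i mod ?p)"
  have gt1: "?p > 1" using p by (rule prime_gt_1_nat)
  have "i < n" if "?p ^ i \<le> m" for i
    using that m gt1 by (metis le_less_trans nat_less_le power_less_imp_less_exp)
  then have "padic_binom ?p s m = prod ?f {..<n}"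
    unfolding padic_binom_def by (intro prod.mono_neutral_left) auto
  also have "\<dots> = (\<Prod>i<n. (nat (s n) div ?p ^ i mod ?p) choose (m div ?p ^ i mod ?p))"
    using padic_digit_eq[OF s] gt1 by simp
  finally show ?thesis
    using binomial_lucas_digits[OF p m, of "nat (s n)"] by simp
qed

text \<open>
  The values at \<open>p\<^sup>j\<close> for \<open>j < i\<close> determine the approximating number modulo \<open>p\<^sup>i\<close>. So a sequence of better
  and better approximations has compatible residues and defines a \<open>p\<close>-adic integer.
\<close>

lemma padic_of_compatible:
  fixes a :: "nat \<Rightarrow> 'k::field"
  assumes p: "prime CHAR('k)" and approx: "\<And>M. \<exists>n. \<forall>m\<le>M. a m = of_nat (n choose m)"
  obtains s where "s \<in> padic_ints CHAR('k)" "\<And>m. a m = of_nat (padic_binom CHAR('k) s m)"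
proof -
  let ?p = "CHAR('k)"
  have gt1: "?p > 1" using p by (rule prime_gt_1_nat)
  \<comment> \<open>Agreement up to \<open>p\<^sup>i\<close> fixes the digits below position \<open>i\<close>, and includes every index \<open>m \<le> i\<close>.\<close>
  have "\<forall>i. \<exists>n. \<forall>m\<le>?p ^ i. a m = of_nat (n choose m)"
    using approx by blast
  then obtain f where f: "\<And>i m. m \<le> ?p ^ i \<Longrightarrow> a m = of_nat (f i choose m)"
    by metis
  have compat: "f (Suc i) mod ?p ^ i = f i mod ?p ^ i" for i
  proof (rule mod_prime_power_eqI[OF p])
    fix j assume "j < i"
    then have "?p ^ j \<le> ?p ^ i" "?p ^ j \<le> ?p ^ Suc i"
      using gt1 by (auto intro!: power_increasing simp del: power_Suc)
    then show "(of_nat (f (Suc i) choose ?p ^ j) :: 'k) = of_nat (f i choose ?p ^ j)"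
      using f by metis
  qed
  define s where "s i = int (f i mod ?p ^ i)" for i
  have s: "s \<in> padic_ints ?p"
  proof -
    have "s (Suc i) mod int ?p ^ i = s i" for i
    proof -
      have "f (Suc i) mod ?p ^ Suc i mod ?p ^ i = f i mod ?p ^ i"
        using compat by (simp add: mod_mod_cancel)
      then show ?thesis unfolding s_def by (metis of_nat_mod of_nat_power)
    qed
    moreover have "s i < int ?p ^ i" for i
      using gt1 by (simp add: s_def flip: of_nat_power)
    ultimately show ?thesis by (auto simp: padic_ints_def s_def)
  qed
  have "a m = of_nat (padic_binom ?p s m)" for m
  proof -
    have m: "m < ?p ^ m" using gt1 by (simp add: power_gt_expt)
    then have "a m = of_nat (f m choose m)" using f by simp
    also have "\<dots> = of_nat (nat (s m) choose m)"
      using binomial_mod_prime_power[OF p m, of "f m"] by (simp add: s_def del: of_nat_mod)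
    also have "\<dots> = of_nat (padic_binom ?p s m)"
      using padic_binom_eq[OF p s m] by simp
    finally show ?thesis .
  qed
  then show thesis using that s by blast
qed

lemma padic_mult_of_int_in:
  assumes "s \<in> padic_ints p" "p > 0"
  shows "padic_mult p (padic_of_int p c) s \<in> padic_ints p"
proof -
  have "(c * s (Suc n)) mod (int p ^ n) = c * s n mod int p ^ n" for n
  proof -
    have "(c * s (Suc n)) mod (int p ^ n) = c * (s (Suc n) mod int p ^ n) mod int p ^ n"
      by (simp add: mod_simps)
    then show ?thesis using assms(1) by (simp add: padic_ints_def)
  qed
  then show ?thesis
    using assms(2) by (simp add: padic_ints_def padic_mult_def padic_of_int_def mod_simps mod_mod_cancel)
qed

lemma padic_diff_of_int_in:
  assumes "t \<in> padic_ints p" "p > 0"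
  shows "padic_diff p t (padic_of_int p c) \<in> padic_ints p"
proof -
  have "(t (Suc n) - c) mod (int p ^ n) = (t n - c) mod int p ^ n" for n
  proof -
    have "(t (Suc n) - c) mod (int p ^ n) = ((t (Suc n) mod int p ^ n) - c) mod int p ^ n"
      by (simp add: mod_simps)
    then show ?thesis using assms(1) by (simp add: padic_ints_def)
  qed
  then show ?thesis
    using assms(2) by (simp add: padic_ints_def padic_diff_def padic_of_int_def mod_simps mod_mod_cancel)
qed

text \<open>
  Substituting \<open>t = d s + c\<close> shows that the parameter \<open>(t - c)/d\<close> runs through all of \<open>\<int>\<^sub>p\<close>.
\<close>

lemma padic_affine_inverse:
  assumes s: "s \<in> padic_ints p" and p: "p > 1" and d: "coprime (int d) (int p)"
  obtains t where "t \<in> padic_ints p"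
    "padic_divide p (padic_diff p t (padic_of_int p c)) (padic_of_int p (int d)) = s"
proof -
  define u where "u = padic_mult p (padic_of_int p (int d)) s"
  \<comment> \<open>Subtracting \<open>-c\<close> adds \<open>c\<close>.\<close>
  define t where "t = padic_diff p u (padic_of_int p (- c))"
  have u: "u \<in> padic_ints p" unfolding u_def using s p by (intro padic_mult_of_int_in) auto
  have t: "t \<in> padic_ints p" unfolding t_def using u p by (intro padic_diff_of_int_in) auto
  have "padic_diff p t (padic_of_int p c) = u"
    using u by (auto simp: t_def padic_diff_def padic_of_int_def mod_simps padic_ints_def)
  then have "padic_divide p (padic_diff p t (padic_of_int p c)) (padic_of_int p (int d)) = s"
    unfolding padic_divide_def using padic_divide_unique[OF p u d] s
    by (intro the1_equality) (auto simp: u_def)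
  then show thesis using that t by blast
qed

text \<open>
  If \<open>d = p e\<close>, then \<open>(\<omega>\<^sup>e - 1)\<^sup>p = \<omega>\<^sup>d - 1 = 0\<close>, and the order of \<open>\<omega>\<close> would divide \<open>e\<close>.
\<close>

lemma primitive_root_coprime_CHAR:
  fixes \<omega> :: "'k::field"
  assumes \<omega>: "primitive_root_of_unity d \<omega>" and p: "prime CHAR('k)"
  shows "coprime (int d) (int CHAR('k))"
proof -
  have "\<not> CHAR('k) dvd d"
  proof
    assume "CHAR('k) dvd d"
    then obtain e where e: "d = CHAR('k) * e" by blast
    have "(\<omega> ^ e - 1 + 1) ^ CHAR('k) = (\<omega> ^ e - 1) ^ CHAR('k) + 1 ^ CHAR('k)"
      by (rule freshmans_dream[OF p refl])
    moreover have "(\<omega> ^ e) ^ CHAR('k) = 1"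
      using \<omega> by (simp add: primitive_root_of_unity_def e mult.commute flip: power_mult)
    ultimately have "\<omega> ^ e = 1" by simp
    moreover have "0 < e" "e < d"
      using \<omega> e prime_gt_1_nat[OF p] by (auto simp: primitive_root_of_unity_def)
    ultimately show False using \<omega> by (auto simp: primitive_root_of_unity_def)
  qed
  then show ?thesis
    using p by (metis coprime_commute coprime_int_iff prime_imp_coprime)
qed

section \<open>Binomial coefficients in characteristic zero\<close>

lemma field_binom_0 [simp]: "field_binom t 0 = 1"
  by (simp add: field_binom_def)

lemma of_nat_neq_0_CHAR_0: "CHAR('k::field) = 0 \<Longrightarrow> n \<noteq> 0 \<Longrightarrow> (of_nat n :: 'k) \<noteq> 0"
  by (simp add: of_nat_eq_0_iff_char_dvd)

lemma field_binom_Suc: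
  assumes "CHAR('k::field) = 0"
  shows "of_nat (Suc m) * field_binom t (Suc m) = (t - of_nat m) * field_binom (t::'k) m"
proof -
  have "(of_nat (Suc m) :: 'k) \<noteq> 0" "(of_nat (fact m) :: 'k) \<noteq> 0"
    using assms by (simp_all only: of_nat_neq_0_CHAR_0 nat.distinct fact_nonzero not_False_eq_True)
  moreover have "(of_nat (fact (Suc m)) :: 'k) = of_nat (Suc m) * of_nat (fact m)"
    by (simp only: fact_Suc of_nat_mult of_nat_id)
  ultimately show ?thesis
    by (simp add: field_binom_def field_simps del: of_nat_Suc fact_Suc)
qed

lemma of_nat_binomial_Suc:
  "(of_nat (Suc m) :: 'a::comm_ring_1) * of_nat (n choose Suc m) = (of_nat n - of_nat m) * of_nat (n choose m)"
proof (cases "m \<le> n")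
  case True
  have "Suc m * (n choose Suc m) = (n - m) * (n choose m)"
    using binomial_absorption[of m n] binomial_absorb_comp[of n m] by simp
  then show ?thesis using True by (metis of_nat_diff of_nat_mult)
qed (simp add: binomial_eq_0)

lemma field_binom_unique:
  assumes "CHAR('k::field) = 0" "a 0 = 1"
    and "\<And>m. of_nat (Suc m) * a (Suc m) = (t - of_nat m) * a m"
  shows "a m = field_binom (t::'k) m"
proof (induction m)
  case (Suc m)
  have "of_nat (Suc m) * a (Suc m) = of_nat (Suc m) * field_binom t (Suc m)"
    unfolding assms(3) field_binom_Suc[OF assms(1)] Suc ..
  then show ?case
    using of_nat_neq_0_CHAR_0[OF assms(1), of "Suc m"] by (simp del: of_nat_Suc)
qed (simp add: assms)

lemma field_binom_of_nat:
  assumes "CHAR('k::field) = 0"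
  shows "field_binom (of_nat n) m = (of_nat (n choose m) :: 'k)"
  using field_binom_unique[OF assms, of "\<lambda>m. of_nat (n choose m)" "of_nat n"] of_nat_binomial_Suc[where 'a='k]
  by simp

section \<open>Homomorphisms that send \<open>q\<close> to zero\<close>

text \<open>
  At \<open>q = 0\<close> the Gaussian binomial coefficients of \<open>n\<close> are the indicator of \<open>m \<le> n\<close>; the case \<open>k = \<infinity>\<close> is
  the limit of evaluations at \<open>[n]\<^sub>q\<close> as \<open>n\<close> grows.
\<close>

lemma admissible_zero_values: "admissible (0::'k::field) (zero_values k)"
proof (cases k)
  case (enat n)
  have "zero_values k = qbinomial (0::'k) n"
    by (auto simp: zero_values_def enat qbinomial_at_0)
  then show ?thesis using admissible_qbinomial by metis
next
  case infinity
  show ?thesis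
  proof (rule admissible_limit)
    show "\<exists>b'. admissible (0::'k) b' \<and> (\<forall>m\<le>M. zero_values k m = b' m)" for M
      using admissible_qbinomial[of 0 M] by (auto simp: zero_values_def infinity qbinomial_at_0)
  qed
qed

text \<open>
  By approximation, every initial segment of the values is an indicator of some \<open>m \<le> n\<close>; so the first
  index with a value other than \<open>1\<close>, if it exists, determines the rest.
\<close>

lemma hom_at_zero:
  fixes \<phi> :: "rat poly fract poly \<Rightarrow> 'k::field"
  assumes \<phi>: "subring_hom Rq_plus \<phi>" "\<phi> [:qvar:] = 0"
  obtains k where "has_values \<phi> 0 (zero_values k)"
proof -
  define b where "b m = \<phi> (q_binom_poly m)" for m
  have approx: "\<exists>n. \<forall>m\<le>M. b m = (if m \<le> n then 1 else 0)" for M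
  proof -
    have "range (\<lambda>n. qbinomial 0 n m) \<subseteq> {0, 1::'k}" for m
      by (auto simp: qbinomial_at_0)
    then have fin: "finite (range (\<lambda>n. qbinomial (0::'k) n m))" for m
      by (rule finite_subset) simp
    obtain n where "\<And>m. m \<in> {..M} \<Longrightarrow> b m = qbinomial 0 n m"
      unfolding b_def using finite_approximation[OF \<phi> finite_atMost fin] by metis
    then show ?thesis by (auto simp: qbinomial_at_0)
  qed
  have "\<exists>k. b = zero_values k"
  proof (cases "\<forall>m. b m = 1")
    case True
    then show ?thesis
      by (intro exI[of _ \<infinity>]) (auto simp: zero_values_def)
  next
    case False
    define l where "l = (LEAST m. b m \<noteq> 1)"
    have l: "b l \<noteq> 1" unfolding l_def using False by (metis (mono_tags, lifting) LeastI)
    have below: "b m = 1" if "m < l" for m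
      using not_less_Least[of m "\<lambda>m. b m \<noteq> 1"] that by (auto simp: l_def)
    have "b 0 = 1" using approx[of 0] by auto
    then obtain n where n: "l = Suc n" using l by (cases l) auto
    have "b m = 0" if "m > n" for m
    proof -
      obtain n' where n': "\<forall>i\<le>m. b i = (if i \<le> n' then 1 else 0)"
        using approx by blast
      have "l \<le> m" using that n by simp
      then have "n' < l" using n' l by (metis not_le)
      then show ?thesis using n' \<open>l \<le> m\<close> by auto
    qed
    then have "b = zero_values (enat n)"
      using below n by (auto simp: zero_values_def fun_eq_iff)
    then show ?thesis by blast
  qed
  then obtain k where "b = zero_values k" by blast
  then have "has_values \<phi> 0 (zero_values k)"
    using \<phi>(2) by (simp add: has_values_def fun_eq_iff b_def)
  then show thesis by (rule that)
qed

section \<open>Homomorphisms that send \<open>q\<close> to a root of unity\<close>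

text \<open>
  The formula is polynomial in the upper entry \<open>s = (t - n\<^sub>0)/d\<close>. At each of the infinitely many \<open>s = n\<close>
  with a natural number \<open>n\<close> it gives the Gaussian binomial coefficients of \<open>d n + n\<^sub>0\<close>.
\<close>

lemma admissible_root_values_char0:
  fixes \<omega> :: "'k::field"
  assumes char: "CHAR('k) = 0" and \<omega>: "primitive_root_of_unity d \<omega>" and n0: "n0 < d"
  shows "admissible \<omega> (root_values_char0 d \<omega> n0 t)"
proof -
  define F where "F m = smult (qbinomial \<omega> n0 (m mod d) / of_nat (fact (m div d)))
      (\<Prod>i<m div d. [:- of_nat i, 1:])" for m
  have F: "poly (F m) s = field_binom s (m div d) * qbinomial \<omega> n0 (m mod d)" for m s
    by (simp add: F_def field_binom_def poly_prod)
  have "inj (of_nat :: nat \<Rightarrow> 'k)"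
    using char by (auto intro!: injI simp: of_nat_eq_iff_cong_CHAR)
  then have "infinite (range (of_nat :: nat \<Rightarrow> 'k))"
    by (simp add: finite_image_iff)
  then have "admissible \<omega> (\<lambda>m. poly (F m) ((t - of_nat n0) / of_nat d))"
  proof (rule admissible_interpolation)
    fix s :: 'k assume "s \<in> range of_nat"
    then obtain n where s: "s = of_nat n" by blast
    have "(\<lambda>m. poly (F m) s) = qbinomial \<omega> (d * n + n0)"
      using n0 by (auto simp: F s field_binom_of_nat[OF char] qbinomial_at_root[OF \<omega>, of "d * n + n0"])
    then show "admissible \<omega> (\<lambda>m. poly (F m) s)"
      using admissible_qbinomial by metis
  qed
  then show ?thesis
    unfolding root_values_char0_def F q_eval_gauss_binom .
qed

text \<open>
  Up to any given index, the values are the Gaussian binomial coefficients of \<open>d n + n\<^sub>0\<close>, where \<open>n\<close> is a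
  residue of the \<open>p\<close>-adic integer \<open>(t - n\<^sub>0)/d\<close> modulo a high power of \<open>p\<close>.
\<close>

lemma admissible_root_values_charp:
  fixes \<omega> :: "'k::field"
  assumes char: "CHAR('k) > 0" and \<omega>: "primitive_root_of_unity d \<omega>" and n0: "n0 < d"
    and t: "t \<in> padic_ints CHAR('k)"
  shows "admissible \<omega> (root_values_charp d \<omega> n0 t)"
proof (rule admissible_limit)
  fix M
  let ?p = "CHAR('k)"
  have p: "prime ?p" using char by (rule prime_CHAR_semidom)
  have gt1: "?p > 1" using p by (rule prime_gt_1_nat)
  define s where "s = padic_divide ?p (padic_diff ?p t (padic_of_int ?p (int n0))) (padic_of_int ?p (int d))"
  have s: "s \<in> padic_ints ?p"
    unfolding s_def padic_divide_def
    using theI'[OF padic_divide_unique[OF gt1 padic_diff_of_int_in[OF t char] primitive_root_coprime_CHAR[OF \<omega> p]]]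
    by blast
  define n where "n = nat (s M)"
  have "root_values_charp d \<omega> n0 t m = qbinomial \<omega> (d * n + n0) m" if "m \<le> M" for m
  proof -
    have "m div d \<le> M" using that by (meson div_le_dividend le_trans)
    also have "M < ?p ^ M" using gt1 by (simp add: power_gt_expt)
    finally have "(of_nat (padic_binom ?p s (m div d)) :: 'k) = of_nat (n choose (m div d))"
      unfolding n_def by (rule padic_binom_eq[OF p s])
    then show ?thesis
      using n0 by (simp add: root_values_charp_def Let_def q_eval_gauss_binom
          qbinomial_at_root[OF \<omega>, of "d * n + n0"] flip: s_def)
  qed
  then show "\<exists>b'. admissible \<omega> b' \<and> (\<forall>m\<le>M. root_values_charp d \<omega> n0 t m = b' m)"
    using admissible_qbinomial by blast
qed

text \<open>
  This holds in every characteristic. Below index \<open>d\<close> the Gaussian binomial coefficients of \<open>N\<close> at \<open>\<omega>\<close>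
  depend on \<open>N mod d\<close> only, so \<open>finite_approximation\<close> gives a common \<open>n\<^sub>0\<close>; the factorisation is a relation
  between Gaussian binomial coefficients at \<open>\<omega>\<close>.
\<close>

lemma hom_at_root:
  fixes \<phi> :: "rat poly fract poly \<Rightarrow> 'k::field"
  assumes \<phi>: "subring_hom Rq_plus \<phi>" "\<phi> [:qvar:] = \<omega>" and \<omega>: "primitive_root_of_unity d \<omega>"
  obtains n0 where "n0 < d"
    "\<And>m. \<phi> (q_binom_poly m) = \<phi> (q_binom_poly (d * (m div d))) * qbinomial \<omega> n0 (m mod d)"
proof -
  interpret subring_hom Rq_plus \<phi> by fact
  interpret ev: subring_hom Zq "q_eval \<omega>" by (rule q_eval_hom_Zq)
  have d: "d > 0" using \<omega> by (simp add: primitive_root_of_unity_def)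
  have low: "qbinomial \<omega> n m = qbinomial \<omega> (n mod d) m" if "m < d" for n m
    using that by (simp add: qbinomial_at_root[OF \<omega>, of n m])
  have "finite (range (\<lambda>n. qbinomial \<omega> n m))" if "m \<in> {..<d}" for m
  proof (rule finite_subset)
    show "range (\<lambda>n. qbinomial \<omega> n m) \<subseteq> (\<lambda>n. qbinomial \<omega> n m) ` {..<d}"
    proof (rule image_subsetI)
      fix n
      have "qbinomial \<omega> n m = qbinomial \<omega> (n mod d) m" using that by (intro low) simp
      then show "qbinomial \<omega> n m \<in> (\<lambda>n. qbinomial \<omega> n m) ` {..<d}"
        using d by (intro image_eqI[of _ _ "n mod d"]) simp_all
    qed
  qed simp
  then obtain N where N: "\<And>m. m \<in> {..<d} \<Longrightarrow> \<phi> (q_binom_poly m) = qbinomial \<omega> N m"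
    using finite_approximation[OF \<phi> finite_lessThan] by metis
  have "\<phi> (q_binom_poly m) = \<phi> (q_binom_poly (d * (m div d))) * qbinomial \<omega> (N mod d) (m mod d)" for m
  proof -
    define P where "P = q_binom_poly (d * (m div d)) * q_binom_poly (m mod d)"
    have P: "P \<in> Rq_plus" by (simp add: P_def subring_mult[OF subring])
    have "\<phi> (q_binom_poly m - P) = 0"
    proof (rule hom_eq_0[OF \<phi>(1)])
      show "q_binom_poly m - P \<in> Rq_plus" using P by (simp add: subring_diff[OF subring])
      fix n
      have "qbinomial \<omega> n m = qbinomial \<omega> n (d * (m div d)) * qbinomial \<omega> n (m mod d)"
        using d qbinomial_at_root[OF \<omega>, of n m] qbinomial_at_root[OF \<omega>, of n "d * (m div d)"]
          low[of "m mod d" n] by simp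
      then show "q_eval (\<phi> [:qvar:]) (poly (q_binom_poly m - P) (q_int (int n))) = 0"
        by (simp add: \<phi>(2) P_def q_binom_poly_at_nat ev.hom_diff ev.hom_mult q_eval_qbinomial
            subring_mult[OF subring_Zq])
    qed
    then have "\<phi> (q_binom_poly m) = \<phi> P"
      using hom_diff[of "q_binom_poly m" P] P by simp
    also have "\<dots> = \<phi> (q_binom_poly (d * (m div d))) * \<phi> (q_binom_poly (m mod d))"
      by (simp add: P_def hom_mult)
    also have "\<phi> (q_binom_poly (m mod d)) = qbinomial \<omega> (N mod d) (m mod d)"
      using d N[of "m mod d"] low[of "m mod d" N] by simp
    finally show ?thesis .
  qed
  then show thesis by (rule that[OF mod_less_divisor[OF d]])
qed

text \<open>
  The values at the multiples of \<open>d\<close> inherit the recurrence of the binomial coefficients of \<open>n div d\<close>, which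
  can be solved in characteristic 0.
\<close>

lemma hom_at_root_char0:
  fixes \<phi> :: "rat poly fract poly \<Rightarrow> 'k::field"
  assumes \<phi>: "subring_hom Rq_plus \<phi>" "\<phi> [:qvar:] = \<omega>" and \<omega>: "primitive_root_of_unity d \<omega>"
    and char: "CHAR('k) = 0"
  obtains n0 t where "n0 < d" "has_values \<phi> \<omega> (root_values_char0 d \<omega> n0 t)"
proof -
  interpret subring_hom Rq_plus \<phi> by fact
  interpret ev: subring_hom Zq "q_eval \<omega>" by (rule q_eval_hom_Zq)
  have d: "d > 0" using \<omega> by (simp add: primitive_root_of_unity_def)
  obtain n0 where n0: "n0 < d"
    and split: "\<And>m. \<phi> (q_binom_poly m) = \<phi> (q_binom_poly (d * (m div d))) * qbinomial \<omega> n0 (m mod d)"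
    using hom_at_root[OF \<phi> \<omega>] by blast
  define a where "a m = \<phi> (q_binom_poly (d * m))" for m
  have a: "a m = field_binom (a 1) m" for m
  proof (rule field_binom_unique[OF char])
    show "a 0 = 1" by (simp add: a_def hom_one)
    fix m
    define P where "P = of_nat (Suc m) * q_binom_poly (d * Suc m)"
    define Q where "Q = (q_binom_poly d - of_nat m) * q_binom_poly (d * m)"
    have nat_in: "of_nat k \<in> Rq_plus" "of_nat k \<in> Zq" for k
      by (rule subring_of_nat[OF subring], rule subring_of_nat[OF subring_Zq])
    have PQ: "P \<in> Rq_plus" "Q \<in> Rq_plus"
      unfolding P_def Q_def
      by (intro subring_mult[OF subring] subring_diff[OF subring] nat_in q_binom_poly_in_Rq_plus)+
    have "\<phi> (P - Q) = 0"
    proof (rule hom_eq_0[OF \<phi>(1) subring_diff[OF subring PQ]])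
      fix n
      have block: "qbinomial \<omega> n (d * k) = of_nat (n div d choose k)" for k
        using d by (simp add: qbinomial_at_root[OF \<omega>, of n "d * k"])
      have "q_eval \<omega> (poly P (q_int (int n))) = of_nat (Suc m) * of_nat (n div d choose Suc m)"
        using nat_in(2)[of "Suc m"]
        by (simp add: P_def q_binom_poly_at_nat ev.hom_mult ev.hom_of_nat q_eval_qbinomial block
            del: of_nat_Suc mult_Suc_right)
      moreover have "q_eval \<omega> (poly Q (q_int (int n))) = (of_nat (n div d) - of_nat m) * of_nat (n div d choose m)"
        using nat_in(2)[of m] block[of 1]
        by (simp add: Q_def q_binom_poly_at_nat ev.hom_mult ev.hom_diff ev.hom_of_nat q_eval_qbinomial block
            subring_diff[OF subring_Zq])
      ultimately show "q_eval (\<phi> [:qvar:]) (poly (P - Q) (q_int (int n))) = 0"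
        using of_nat_binomial_Suc[of m "n div d", where 'a='k] PQ
        by (simp add: \<phi>(2) ev.hom_diff poly_at_nat_in_Zq)
    qed
    then have "\<phi> P = \<phi> Q" using hom_diff[OF PQ] by simp
    moreover have "\<phi> P = of_nat (Suc m) * a (Suc m)"
      unfolding P_def a_def by (simp only: hom_mult hom_of_nat nat_in q_binom_poly_in_Rq_plus)
    moreover have "\<phi> Q = (a 1 - of_nat m) * a m"
      unfolding Q_def a_def
      by (simp only: hom_mult hom_diff hom_of_nat nat_in q_binom_poly_in_Rq_plus subring_diff[OF subring] mult_1_right)
    ultimately show "of_nat (Suc m) * a (Suc m) = (a 1 - of_nat m) * a m" by simp
  qed
  define t where "t = of_nat d * a 1 + of_nat n0"
  have "(t - of_nat n0) / of_nat d = a 1"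
    using of_nat_neq_0_CHAR_0[OF char, of d] d by (simp add: t_def)
  then have "\<phi> (q_binom_poly m) = root_values_char0 d \<omega> n0 t m" for m
    unfolding split[of m] a_def[symmetric] a[of "m div d"] root_values_char0_def q_eval_gauss_binom
    by (simp only:)
  then have "has_values \<phi> \<omega> (root_values_char0 d \<omega> n0 t)"
    using \<phi>(2) by (simp add: has_values_def)
  then show thesis using that n0 by blast
qed

text \<open>
  At the multiples of \<open>d\<close> the Gaussian binomial coefficients at \<open>\<omega>\<close> lie in the prime field, so any finite
  number of the values of the homomorphism are binomial coefficients of a common natural number.
\<close>

lemma hom_at_root_charp:
  fixes \<phi> :: "rat poly fract poly \<Rightarrow> 'k::field"
  assumes \<phi>: "subring_hom Rq_plus \<phi>" "\<phi> [:qvar:] = \<omega>" and \<omega>: "primitive_root_of_unity d \<omega>"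
    and char: "CHAR('k) > 0"
  obtains n0 t where "n0 < d" "t \<in> padic_ints CHAR('k)" "has_values \<phi> \<omega> (root_values_charp d \<omega> n0 t)"
proof -
  let ?p = "CHAR('k)"
  have p: "prime ?p" using char by (rule prime_CHAR_semidom)
  have d: "d > 0" using \<omega> by (simp add: primitive_root_of_unity_def)
  obtain n0 where n0: "n0 < d"
    and split: "\<And>m. \<phi> (q_binom_poly m) = \<phi> (q_binom_poly (d * (m div d))) * qbinomial \<omega> n0 (m mod d)"
    using hom_at_root[OF \<phi> \<omega>] by blast
  have block: "qbinomial \<omega> n (d * k) = of_nat (n div d choose k)" for n k
    using d by (simp add: qbinomial_at_root[OF \<omega>, of n "d * k"])
  have "(of_nat n :: 'k) \<in> of_nat ` {..<?p}" for n
  proof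
    show "(of_nat n :: 'k) = of_nat (n mod ?p)"
      by (simp add: of_nat_eq_iff_cong_CHAR cong_def)
    show "n mod ?p \<in> {..<?p}" using char by simp
  qed
  then have "range (\<lambda>n. qbinomial \<omega> n (d * k)) \<subseteq> of_nat ` {..<?p}" for k
    by (auto simp: block)
  then have fin: "finite (range (\<lambda>n. qbinomial \<omega> n (d * k)))" for k
    using finite_subset by blast
  have approx: "\<exists>n. \<forall>k\<le>M. \<phi> (q_binom_poly (d * k)) = of_nat (n choose k)" for M
  proof -
    have "finite (range (\<lambda>n. qbinomial \<omega> n m))" if "m \<in> (*) d ` {..M}" for m
      using that fin by auto
    from finite_approximation[OF \<phi> _ this]
    obtain n where "\<And>m. m \<in> (*) d ` {..M} \<Longrightarrow> \<phi> (q_binom_poly m) = qbinomial \<omega> n m"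
      by (metis finite_atMost finite_imageI)
    then have "\<phi> (q_binom_poly (d * k)) = of_nat (n div d choose k)" if "k \<le> M" for k
      using that block[of n k] by (metis atMost_iff image_eqI)
    then show ?thesis by blast
  qed
  obtain s where s: "s \<in> padic_ints ?p" "\<And>k. \<phi> (q_binom_poly (d * k)) = of_nat (padic_binom ?p s k)"
    by (rule padic_of_compatible[of "\<lambda>k. \<phi> (q_binom_poly (d * k))", OF p approx]) blast
  obtain t where t: "t \<in> padic_ints ?p"
    "padic_divide ?p (padic_diff ?p t (padic_of_int ?p (int n0))) (padic_of_int ?p (int d)) = s"
    using padic_affine_inverse[OF s(1) prime_gt_1_nat[OF p] primitive_root_coprime_CHAR[OF \<omega> p]] by blast
  have "\<phi> (q_binom_poly m) = root_values_charp d \<omega> n0 t m" for m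
    unfolding split[of m] s(2) root_values_charp_def t(2) Let_def q_eval_gauss_binom ..
  then have "has_values \<phi> \<omega> (root_values_charp d \<omega> n0 t)"
    using \<phi>(2) by (simp add: has_values_def)
  then show thesis using that n0 t(1) by blast
qed

section \<open>Homomorphisms that send \<open>q\<close> to any other element\<close>

lemma not_root_of_unity_qnat:
  fixes \<kappa> :: "'k::field"
  assumes "\<kappa> \<noteq> 0" "\<not> root_of_unity \<kappa>"
  shows "qnat \<kappa> (Suc m) \<noteq> 0" and "inj (qnat \<kappa>)"
proof -
  have pow: "\<kappa> ^ n \<noteq> 1" if "n > 0" for n
    using assms(2) that unfolding root_of_unity_def by blast
  show "qnat \<kappa> (Suc m) \<noteq> 0"
    using qnat_mult[of \<kappa> "Suc m"] pow[of "Suc m"] by auto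
  have "m = n" if "qnat \<kappa> m = qnat \<kappa> n" "m \<le> n" for m n
  proof (rule ccontr)
    assume "m \<noteq> n"
    have "\<kappa> ^ m = \<kappa> ^ n"
      using that qnat_mult[of \<kappa> m] qnat_mult[of \<kappa> n] by simp
    also have "\<dots> = \<kappa> ^ m * \<kappa> ^ (n - m)"
      using that by (simp flip: power_add)
    finally have "\<kappa> ^ (n - m) = 1" using assms(1) by simp
    then show False using pow[of "n - m"] that \<open>m \<noteq> n\<close> by simp
  qed
  then show "inj (qnat \<kappa>)"
    by (metis injI linear)
qed

text \<open>
  Elements of \<open>\<int>[q]\<close> that do not vanish at \<open>\<kappa>\<close> are units of the local ring. This is how the denominators
  of the \<open>B\<^sub>m\<close> are handled.
\<close>

lemma regular_at_cancel:
  assumes "e \<in> Zq" "q_eval \<kappa> e \<noteq> 0" "e * r \<in> regular_at \<kappa>"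
  shows "r \<in> regular_at \<kappa>"
proof -
  obtain h where h: "e = of_Zq h" using assms(1) by (auto simp: Zq_def)
  have "e \<noteq> 0" using assms(2) by auto
  have "1 / e \<in> regular_at \<kappa>"
    using regular_at_divide[of h \<kappa> 1] assms(2) by (simp add: h)
  then have "1 / e * (e * r) \<in> regular_at \<kappa>"
    using assms(3) subring_mult[OF subring_hom.subring[OF q_eval_hom_regular_at]] by blast
  then show ?thesis using \<open>e \<noteq> 0\<close> by simp
qed

lemma q_int_nat_in_Zq: "q_int (int n) \<in> Zq"
  using qbinomial_in_Zq[of n "Suc 0"] by (simp only: q_int_of_nat qbinomial_1)

lemma q_eval_q_int: "q_eval \<kappa> (q_int (int n)) = qnat \<kappa> n"
  unfolding q_int_of_nat using subring_hom.hom_qnat[OF q_eval_hom_Zq qvar_in_Zq, of \<kappa> n] by simp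

lemma q_eval_q_binom_poly_denominator:
  "qvar ^ k * q_int (int (Suc k)) \<in> Zq"
  "q_eval \<kappa> (qvar ^ k * q_int (int (Suc k))) = \<kappa> ^ k * qnat \<kappa> (Suc k)"
proof -
  interpret subring_hom Zq "q_eval \<kappa>" by (rule q_eval_hom_Zq)
  have mem: "qvar ^ k \<in> Zq" "q_int (int (Suc k)) \<in> Zq"
    by (simp add: subring_power[OF subring], rule q_int_nat_in_Zq)
  then show "qvar ^ k * q_int (int (Suc k)) \<in> Zq"
    by (rule subring_mult[OF subring])
  show "q_eval \<kappa> (qvar ^ k * q_int (int (Suc k))) = \<kappa> ^ k * qnat \<kappa> (Suc k)"
    using hom_mult[OF mem] hom_power[OF qvar_in_Zq] q_eval_q_int[of \<kappa> "Suc k"] by simp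
qed

lemma q_binom_eval_0 [simp]: "q_binom_eval \<kappa> t 0 = 1"
  by (simp add: q_binom_eval_def)

text \<open>
  The recurrence of the \<open>B\<^sub>k\<close> holds coefficientwise. It shows first that all coefficients are regular at
  \<open>\<kappa>\<close>, and can then be specialised.
\<close>

lemma q_binom_eval_Suc:
  fixes \<kappa> :: "'k::field"
  assumes \<kappa>: "\<kappa> \<noteq> 0" "\<not> root_of_unity \<kappa>"
  shows "\<kappa> ^ k * qnat \<kappa> (Suc k) * q_binom_eval \<kappa> t (Suc k) = (t - qnat \<kappa> k) * q_binom_eval \<kappa> t k"
proof -
  interpret subring_hom "regular_at \<kappa>" "q_eval \<kappa>" by (rule q_eval_hom_regular_at)
  define e where "e k = qvar ^ k * q_int (int (Suc k))" for k
  have e: "e k \<in> Zq" "q_eval \<kappa> (e k) = \<kappa> ^ k * qnat \<kappa> (Suc k)" for k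
    unfolding e_def by (rule q_eval_q_binom_poly_denominator)+
  have e_nz: "q_eval \<kappa> (e k) \<noteq> 0" for k
    using \<kappa>(1) not_root_of_unity_qnat(1)[OF \<kappa>] by (simp add: e(2))
  let ?c = "\<lambda>k n. coeff (q_binom_poly k) n"
  have rec: "e k * ?c (Suc k) n = (case n of 0 \<Rightarrow> 0 | Suc j \<Rightarrow> ?c k j) - q_int (int k) * ?c k n" for k n
    using arg_cong[OF q_binom_poly_Suc[of k], of "\<lambda>P. coeff P n"]
    by (simp add: e_def coeff_pCons split: nat.split)
  have q: "q_int (int k) \<in> regular_at \<kappa>" "e k \<in> regular_at \<kappa>" for k
    using q_int_nat_in_Zq e(1) Zq_regular_at by auto
  have reg: "?c k n \<in> regular_at \<kappa>" for k n
  proof (induction k arbitrary: n)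
    case 0
    then show ?case
      by (cases n) (simp_all add: one_pCons subring_zero[OF subring] subring_one[OF subring])
  next
    case (Suc k)
    have "e k * ?c (Suc k) n \<in> regular_at \<kappa>"
      unfolding rec using Suc q subring_zero[OF subring]
      by (intro subring_diff[OF subring] subring_mult[OF subring]) (auto split: nat.split)
    then show ?case using e(1) e_nz regular_at_cancel by blast
  qed
  have "smult (q_eval \<kappa> (e k)) (map_poly (q_eval \<kappa>) (q_binom_poly (Suc k))) =
      [:- qnat \<kappa> k, 1:] * map_poly (q_eval \<kappa>) (q_binom_poly k)"
  proof (rule poly_eqI)
    fix n
    have "q_eval \<kappa> (e k) * q_eval \<kappa> (?c (Suc k) n) =
        (case n of 0 \<Rightarrow> 0 | Suc j \<Rightarrow> q_eval \<kappa> (?c k j)) - qnat \<kappa> k * q_eval \<kappa> (?c k n)"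
      using arg_cong[OF rec[of k n], of "q_eval \<kappa>"] reg q hom_diff[OF subring_zero[OF subring]]
      by (cases n) (simp_all add: hom_mult hom_diff q_eval_q_int subring_mult[OF subring] subring_zero[OF subring])
    then show "coeff (smult (q_eval \<kappa> (e k)) (map_poly (q_eval \<kappa>) (q_binom_poly (Suc k)))) n =
        coeff ([:- qnat \<kappa> k, 1:] * map_poly (q_eval \<kappa>) (q_binom_poly k)) n"
      by (cases n) (simp_all add: coeff_map_poly coeff_pCons)
  qed
  from arg_cong[OF this, of "\<lambda>P. poly P t"] show ?thesis
    by (simp add: q_binom_eval_def e(2) algebra_simps)
qed

lemma q_binom_eval_unique:
  fixes \<kappa> :: "'k::field"
  assumes \<kappa>: "\<kappa> \<noteq> 0" "\<not> root_of_unity \<kappa>" and "b 0 = 1"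
    and rec: "\<And>k. \<kappa> ^ k * qnat \<kappa> (Suc k) * b (Suc k) = (t - qnat \<kappa> k) * b k"
  shows "b = q_binom_eval \<kappa> t"
proof
  fix k show "b k = q_binom_eval \<kappa> t k"
  proof (induction k)
    case (Suc k)
    have "\<kappa> ^ k * qnat \<kappa> (Suc k) * b (Suc k) = \<kappa> ^ k * qnat \<kappa> (Suc k) * q_binom_eval \<kappa> t (Suc k)"
      unfolding rec q_binom_eval_Suc[OF \<kappa>] Suc ..
    then show ?case
      using \<kappa>(1) not_root_of_unity_qnat(1)[OF \<kappa>] by simp
  qed (simp add: \<open>b 0 = 1\<close>)
qed

text \<open>
  The recurrence \<open>q\<^sup>k [k + 1]\<^sub>q B\<^bsub>k+1\<^esub> = (x - [k]\<^sub>q) B\<^sub>k\<close> is a relation inside \<open>Rq_plus\<close> because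
  \<open>x = B\<^sub>1\<close>.
\<close>

lemma hom_recurrence:
  fixes \<phi> :: "rat poly fract poly \<Rightarrow> 'k::field"
  assumes \<phi>: "subring_hom Rq_plus \<phi>" "\<phi> [:qvar:] = \<kappa>"
  shows "\<kappa> ^ k * qnat \<kappa> (Suc k) * \<phi> (q_binom_poly (Suc k)) =
    (\<phi> (q_binom_poly 1) - qnat \<kappa> k) * \<phi> (q_binom_poly k)"
proof -
  interpret subring_hom Rq_plus \<phi> by fact
  define e where "e = qvar ^ k * q_int (int (Suc k))"
  have mem: "[:e:] \<in> Rq_plus" "[:q_int (int k):] \<in> Rq_plus"
    unfolding e_def by (intro const_in_Rq_plus q_eval_q_binom_poly_denominator q_int_nat_in_Zq)+
  have "q_binom_poly 1 = [:0, 1:]"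
    using q_binom_poly_Suc[of 0] by simp
  then have "[:e:] * q_binom_poly (Suc k) = (q_binom_poly 1 - [:q_int (int k):]) * q_binom_poly k"
    using q_binom_poly_Suc[of k] by (simp add: e_def)
  then have "\<phi> ([:e:] * q_binom_poly (Suc k)) = \<phi> ((q_binom_poly 1 - [:q_int (int k):]) * q_binom_poly k)"
    by (rule arg_cong)
  then have "\<phi> [:e:] * \<phi> (q_binom_poly (Suc k)) = (\<phi> (q_binom_poly 1) - \<phi> [:q_int (int k):]) * \<phi> (q_binom_poly k)"
    using mem by (simp only: hom_mult hom_diff q_binom_poly_in_Rq_plus subring_diff[OF subring])
  moreover have "\<phi> [:e:] = \<kappa> ^ k * qnat \<kappa> (Suc k)"
    using hom_const[OF \<phi>(1) q_eval_q_binom_poly_denominator(1)[of k]] q_eval_q_binom_poly_denominator(2)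
    by (simp only: e_def \<phi>(2))
  moreover have "\<phi> [:q_int (int k):] = qnat \<kappa> k"
    using hom_const[OF \<phi>(1) q_int_nat_in_Zq[of k]] by (simp only: \<phi>(2) q_eval_q_int)
  ultimately show ?thesis by simp
qed

lemma hom_at_generic:
  fixes \<phi> :: "rat poly fract poly \<Rightarrow> 'k::field"
  assumes \<phi>: "subring_hom Rq_plus \<phi>" "\<phi> [:qvar:] = \<kappa>" and \<kappa>: "\<kappa> \<noteq> 0" "\<not> root_of_unity \<kappa>"
  obtains t where "has_values \<phi> \<kappa> (q_binom_eval \<kappa> t)"
proof -
  have "(\<lambda>m. \<phi> (q_binom_poly m)) = q_binom_eval \<kappa> (\<phi> (q_binom_poly 1))"
    using subring_hom.hom_one[OF \<phi>(1)] hom_recurrence[OF \<phi>]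
    by (intro q_binom_eval_unique[OF \<kappa>]) simp_all
  then show thesis using that \<phi>(2) by (metis has_values_def)
qed

text \<open>
  The homomorphism that evaluates at \<open>[n]\<^sub>q\<close> satisfies the recurrence that characterises
  \<open>q_binom_eval\<close>.
\<close>

lemma qbinomial_eq_q_binom_eval:
  fixes \<kappa> :: "'k::field"
  assumes \<kappa>: "\<kappa> \<noteq> 0" "\<not> root_of_unity \<kappa>"
  shows "q_binom_eval \<kappa> (qnat \<kappa> n) = qbinomial \<kappa> n"
proof -
  obtain \<phi> where \<phi>: "\<phi> \<in> ring_homs Rq_plus" "has_values \<phi> \<kappa> (qbinomial \<kappa> n)"
    using ex1_ring_hom[OF admissible_qbinomial] by blast
  then have "subring_hom Rq_plus \<phi>" by (simp add: ring_homs_iff subring_Rq_plus)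
  from hom_recurrence[OF this, of \<kappa>] show ?thesis
    using \<phi>(2) by (intro q_binom_eval_unique[OF \<kappa>, symmetric]) (auto simp: has_values_def qbinomial_1)
qed

text \<open>
  The values are polynomial in \<open>t\<close>, and the points \<open>[n]\<^sub>\<kappa>\<close>, where they are Gaussian binomial coefficients,
  are pairwise distinct as \<open>\<kappa>\<close> is neither zero nor a root of unity.
\<close>

lemma admissible_q_binom_eval:
  fixes \<kappa> :: "'k::field"
  assumes \<kappa>: "\<kappa> \<noteq> 0" "\<not> root_of_unity \<kappa>"
  shows "admissible \<kappa> (q_binom_eval \<kappa> t)"
proof -
  have "infinite (range (qnat \<kappa>))"
    using not_root_of_unity_qnat(2)[OF \<kappa>] by (simp add: finite_image_iff)
  then have "admissible \<kappa> (\<lambda>m. poly (map_poly (q_eval \<kappa>) (q_binom_poly m)) t)"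
  proof (rule admissible_interpolation)
    fix s assume "s \<in> range (qnat \<kappa>)"
    then show "admissible \<kappa> (\<lambda>m. poly (map_poly (q_eval \<kappa>) (q_binom_poly m)) s)"
      using admissible_qbinomial qbinomial_eq_q_binom_eval[OF \<kappa>]
      unfolding q_binom_eval_def[symmetric] by auto
  qed
  then show ?thesis unfolding q_binom_eval_def[symmetric] .
qed

section \<open>The classification\<close>

lemma root_of_unity_primitive:
  assumes "root_of_unity \<kappa>"
  obtains d where "primitive_root_of_unity d \<kappa>"
proof -
  have "\<exists>d. 0 < d \<and> \<kappa> ^ d = 1" using assms unfolding root_of_unity_def by blast
  then obtain d where "0 < d \<and> \<kappa> ^ d = 1" "\<forall>e<d. \<not> (0 < e \<and> \<kappa> ^ e = 1)"
    using exists_least_iff[of "\<lambda>d. 0 < d \<and> \<kappa> ^ d = 1"] by blast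
  then have "primitive_root_of_unity d \<kappa>"
    unfolding primitive_root_of_unity_def by blast
  then show thesis by (rule that)
qed

lemma ring_homs_Rq_plus_classification:
  fixes \<phi> :: "rat poly fract poly \<Rightarrow> 'k::field"
  assumes "\<phi> \<in> ring_homs Rq_plus"
  shows "(\<exists>k::enat. has_values \<phi> 0 (zero_values k)) \<or>
        (\<exists>d \<omega> n0 t. CHAR('k) = 0 \<and> primitive_root_of_unity d \<omega> \<and> n0 < d \<and>
           has_values \<phi> \<omega> (root_values_char0 d \<omega> n0 t)) \<or>
        (\<exists>d \<omega> n0 t. CHAR('k) > 0 \<and> primitive_root_of_unity d \<omega> \<and> n0 < d \<and>
           t \<in> padic_ints CHAR('k) \<and> has_values \<phi> \<omega> (root_values_charp d \<omega> n0 t)) \<or>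
        (\<exists>\<kappa> t. \<kappa> \<noteq> 0 \<and> \<not> root_of_unity \<kappa> \<and> has_values \<phi> \<kappa> (q_binom_eval \<kappa> t))"
proof -
  have \<phi>: "subring_hom Rq_plus \<phi>"
    using assms by (simp add: ring_homs_iff subring_Rq_plus)
  consider (zero) "\<phi> [:qvar:] = 0" | (root) "root_of_unity (\<phi> [:qvar:])"
    | (generic) "\<phi> [:qvar:] \<noteq> 0" "\<not> root_of_unity (\<phi> [:qvar:])"
    by blast
  then show ?thesis
  proof cases
    case zero
    obtain k where "has_values \<phi> 0 (zero_values k)" by (rule hom_at_zero[OF \<phi> zero])
    then show ?thesis by blast
  next
    case root
    obtain d where d: "primitive_root_of_unity d (\<phi> [:qvar:])"
      by (rule root_of_unity_primitive[OF root])
    show ?thesis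
    proof (cases "CHAR('k) = 0")
      case True
      obtain n0 t where "n0 < d" "has_values \<phi> (\<phi> [:qvar:]) (root_values_char0 d (\<phi> [:qvar:]) n0 t)"
        by (rule hom_at_root_char0[OF \<phi> refl d True])
      then show ?thesis using d True by blast
    next
      case False
      then have char: "CHAR('k) > 0" by simp
      obtain n0 t where "n0 < d" "t \<in> padic_ints CHAR('k)"
        "has_values \<phi> (\<phi> [:qvar:]) (root_values_charp d (\<phi> [:qvar:]) n0 t)"
        by (rule hom_at_root_charp[OF \<phi> refl d char])
      then show ?thesis using d char by blast
    qed
  next
    case generic
    obtain t where "has_values \<phi> (\<phi> [:qvar:]) (q_binom_eval (\<phi> [:qvar:]) t)"
      by (rule hom_at_generic[OF \<phi> refl generic])
    then show ?thesis using generic by blast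
  qed
qed

lemma primitive_root_neq_0: "primitive_root_of_unity d \<omega> \<Longrightarrow> \<omega> \<noteq> 0"
  by (auto simp: primitive_root_of_unity_def power_0_left)

theorem theorem8p1:
  shows
    \<comment> \<open>the listed data define unique ring homomorphisms from \<open>Rq_plus\<close>\<close>
    "(\<forall>k::enat. \<exists>!\<phi>. \<phi> \<in> ring_homs Rq_plus \<and> has_values \<phi> (0::'k::field) (zero_values k)) \<and>
     (\<forall>d (\<omega>::'k) n0 t.
        CHAR('k) = 0 \<and> primitive_root_of_unity d \<omega> \<and> n0 < d \<longrightarrow>
        (\<exists>!\<phi>. \<phi> \<in> ring_homs Rq_plus \<and> has_values \<phi> \<omega> (root_values_char0 d \<omega> n0 t))) \<and>
     (\<forall>d (\<omega>::'k) n0 t.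
        CHAR('k) > 0 \<and> primitive_root_of_unity d \<omega> \<and> n0 < d \<and> t \<in> padic_ints CHAR('k) \<longrightarrow>
        (\<exists>!\<phi>. \<phi> \<in> ring_homs Rq_plus \<and> has_values \<phi> \<omega> (root_values_charp d \<omega> n0 t))) \<and>
     (\<forall>(\<kappa>::'k) t.
        \<kappa> \<noteq> 0 \<and> \<not> root_of_unity \<kappa> \<longrightarrow>
        (\<exists>!\<phi>. \<phi> \<in> ring_homs Rq_plus \<and> has_values \<phi> \<kappa> (q_binom_eval \<kappa> t))) \<and>
     \<comment> \<open>every ring homomorphism from \<open>Rq_plus\<close> is of one of these forms\<close>
     (\<forall>\<phi> \<in> (ring_homs Rq_plus :: (rat poly fract poly \<Rightarrow> 'k) set).
        (\<exists>k::enat. has_values \<phi> 0 (zero_values k)) \<or>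
        (\<exists>d \<omega> n0 t. CHAR('k) = 0 \<and> primitive_root_of_unity d \<omega> \<and> n0 < d \<and>
           has_values \<phi> \<omega> (root_values_char0 d \<omega> n0 t)) \<or>
        (\<exists>d \<omega> n0 t. CHAR('k) > 0 \<and> primitive_root_of_unity d \<omega> \<and> n0 < d \<and>
           t \<in> padic_ints CHAR('k) \<and> has_values \<phi> \<omega> (root_values_charp d \<omega> n0 t)) \<or>
        (\<exists>\<kappa> t. \<kappa> \<noteq> 0 \<and> \<not> root_of_unity \<kappa> \<and> has_values \<phi> \<kappa> (q_binom_eval \<kappa> t))) \<and>
     \<comment> \<open>the same for \<open>Rq\<close>, where the first form does not occur\<close>
     (\<forall>d (\<omega>::'k) n0 t.
        CHAR('k) = 0 \<and> primitive_root_of_unity d \<omega> \<and> n0 < d \<longrightarrow>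
        (\<exists>!\<phi>. \<phi> \<in> ring_homs Rq \<and> has_values \<phi> \<omega> (root_values_char0 d \<omega> n0 t))) \<and>
     (\<forall>d (\<omega>::'k) n0 t.
        CHAR('k) > 0 \<and> primitive_root_of_unity d \<omega> \<and> n0 < d \<and> t \<in> padic_ints CHAR('k) \<longrightarrow>
        (\<exists>!\<phi>. \<phi> \<in> ring_homs Rq \<and> has_values \<phi> \<omega> (root_values_charp d \<omega> n0 t))) \<and>
     (\<forall>(\<kappa>::'k) t.
        \<kappa> \<noteq> 0 \<and> \<not> root_of_unity \<kappa> \<longrightarrow>
        (\<exists>!\<phi>. \<phi> \<in> ring_homs Rq \<and> has_values \<phi> \<kappa> (q_binom_eval \<kappa> t))) \<and>
     (\<forall>\<phi> \<in> (ring_homs Rq :: (rat poly fract poly \<Rightarrow> 'k) set).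
        (\<exists>d \<omega> n0 t. CHAR('k) = 0 \<and> primitive_root_of_unity d \<omega> \<and> n0 < d \<and>
           has_values \<phi> \<omega> (root_values_char0 d \<omega> n0 t)) \<or>
        (\<exists>d \<omega> n0 t. CHAR('k) > 0 \<and> primitive_root_of_unity d \<omega> \<and> n0 < d \<and>
           t \<in> padic_ints CHAR('k) \<and> has_values \<phi> \<omega> (root_values_charp d \<omega> n0 t)) \<or>
        (\<exists>\<kappa> t. \<kappa> \<noteq> 0 \<and> \<not> root_of_unity \<kappa> \<and> has_values \<phi> \<kappa> (q_binom_eval \<kappa> t))) \<and>
     (\<forall>\<phi> \<in> (ring_homs Rq :: (rat poly fract poly \<Rightarrow> 'k) set). \<phi> [:qvar:] \<noteq> 0)"
proof -
  note zero = ex1_ring_hom[OF admissible_zero_values]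
  note char0 = ex1_ring_hom[OF admissible_root_values_char0]
  note charp = ex1_ring_hom[OF admissible_root_values_charp]
  note generic = ex1_ring_hom[OF admissible_q_binom_eval]
  have Rq: "(\<exists>d \<omega> n0 t. CHAR('k) = 0 \<and> primitive_root_of_unity d \<omega> \<and> n0 < d \<and>
           has_values \<phi> \<omega> (root_values_char0 d \<omega> n0 t)) \<or>
        (\<exists>d \<omega> n0 t. CHAR('k) > 0 \<and> primitive_root_of_unity d \<omega> \<and> n0 < d \<and>
           t \<in> padic_ints CHAR('k) \<and> has_values \<phi> \<omega> (root_values_charp d \<omega> n0 t)) \<or>
        (\<exists>\<kappa> t. \<kappa> \<noteq> 0 \<and> \<not> root_of_unity \<kappa> \<and> has_values \<phi> \<kappa> (q_binom_eval \<kappa> t))"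
    if \<phi>: "\<phi> \<in> ring_homs Rq" for \<phi> :: "rat poly fract poly \<Rightarrow> 'k"
  proof -
    have "\<not> has_values \<phi> 0 b" for b
      using Rq_hom_qvar_neq_0[OF \<phi>] by (simp add: has_values_def)
    then show ?thesis
      using ring_homs_Rq_plus_classification[OF Rq_hom_restrict(1)[OF \<phi>]]
      unfolding Rq_hom_restrict(2)[OF \<phi>] by simp
  qed
  show ?thesis
  proof (intro conjI allI ballI impI, goal_cases)
    case 1
    show ?case by (rule zero)
  next
    case 2
    then show ?case by (elim conjE) (rule char0)
  next
    case 3
    then show ?case by (elim conjE) (rule charp)
  next
    case 4
    then show ?case by (elim conjE) (rule generic)
  next
    case 5
    then show ?case by (rule ring_homs_Rq_plus_classification)
  next
    case 6
    then show ?case by (elim conjE) (rule ex1_ring_hom_Rq[OF char0 primitive_root_neq_0])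
  next
    case 7
    then show ?case by (elim conjE) (rule ex1_ring_hom_Rq[OF charp primitive_root_neq_0])
  next
    case 8
    then show ?case by (elim conjE) (rule ex1_ring_hom_Rq[OF generic])
  next
    case 9
    then show ?case by (rule Rq)
  next
    case 10
    then show ?case by (rule Rq_hom_qvar_neq_0)
  qed
qed

end
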